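(* Let $1<p<\infty$. There exists a constant $c_p>0$ depending only on $p$ such that for every weight $w\in A_p^+$ and every $f\in L^p(w)$, \[ \|M^{+}f\|_{L^{p}(w)}\leq c_{p}\,[w]_{A_{p}^{+}}^{\frac{1}{p-1}}\|f\|_{L^{p}(w)}. \] Furthermore, \[ \|M^{+}f\|_{L^{p}(w)}\leq c_{p}\,\big([w]_{A_{p}^{+}}[\sigma]_{A_{\infty}^{-}}\big)^{\frac{1}{p}}\|f\|_{L^{p}(w)}, \] where $\sigma=w^{-\frac{1}{p-1}}$.
   Context: A weight is a nonnegative measurable function on $\mathbb{R}$; $w(E)=\int_E w(x)\,dx$, and $\|f\|_{L^p(w)}=\left(\int_{\mathbb{R}}|f|^pw\right)^{1/p}$. The one-sided maximal operator is $M^{+}f(x)=\sup_{h>0}\frac{1}{h}\int_{x}^{x+h}|f(y)|\,dy$. For $1<p<\infty$, $w\in A_p^+$ means \[ [w]_{A_{p}^{+}}=\sup_{a<b<c}\frac{1}{c-a}\int_{a}^{b}w\left(\frac{1}{c-a}\int_{b}^{c}w^{-\frac{1}{p-1}}\right)^{p-1}<\infty . \] Also \[ [\sigma]_{A_{\infty}^{-}}=\sup_{a<b}\frac{1}{\sigma(a,b)}\int_{a}^{b}M^{+}(\sigma\chi_{(a,b)}). \] *)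

theory Defs
  imports "HOL-Analysis.Analysis"
begin

text \<open>
  All integrals are Lebesgue integrals of \<open>[0,\<infinity>]\<close>-valued functions, so that every norm, average
  and weight constant below is meaningful (possibly infinite) without integrability hypotheses.
  The arithmetic of \<^typ>\<open>ennreal\<close> supplies the usual conventions:
  \<open>0 * \<infinity> = 0\<close>, \<open>1 / 0 = \<infinity>\<close>, \<open>0 / 0 = 0\<close> and \<open>\<infinity> / \<infinity> = 0\<close>.
\<close>

text \<open>
  Real powers on \<open>[0,\<infinity>]\<close>, with \<open>0 powr a = \<infinity>\<close> for \<open>a < 0\<close>
  (the real \<open>powr\<close> of the library has \<open>0 powr a = 0\<close> for every \<open>a\<close>).
\<close>

definition epowr :: "ennreal \<Rightarrow> real \<Rightarrow> ennreal"  (infixr "epowr" 80) where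
  "x epowr a =
    (if a = 0 then 1
     else if x = 0 then (if a < 0 then \<infinity> else 0)
     else if x = \<infinity> then (if a < 0 then 0 else \<infinity>)
     else ennreal (enn2real x powr a))"

definition weight :: "(real \<Rightarrow> real) \<Rightarrow> bool" where
  "weight w \<longleftrightarrow> w \<in> borel_measurable lebesgue \<and> (\<forall>x. 0 \<le> w x)"

definition Lp_norm :: "real \<Rightarrow> (real \<Rightarrow> real) \<Rightarrow> (real \<Rightarrow> ennreal) \<Rightarrow> ennreal" where
  "Lp_norm p w g = (\<integral>\<^sup>+x. (g x epowr p) * ennreal (w x) \<partial>lebesgue) epowr (1 / p)"

definition in_Lp :: "real \<Rightarrow> (real \<Rightarrow> real) \<Rightarrow> (real \<Rightarrow> real) \<Rightarrow> bool" where
  "in_Lp p w f \<longleftrightarrow>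
    f \<in> borel_measurable lebesgue \<and> Lp_norm p w (\<lambda>x. ennreal \<bar>f x\<bar>) < \<infinity>"

text \<open>
  The one-sided maximal operator only sees \<open>\<bar>f\<bar>\<close>; it is applied to \<open>\<bar>f\<bar>\<close> for real-valued \<open>f\<close>,
  and to \<open>\<sigma> \<chi>\<close> where \<open>\<sigma>\<close> is infinite at the zeros of \<open>w\<close>.
\<close>

definition maxplus :: "(real \<Rightarrow> ennreal) \<Rightarrow> real \<Rightarrow> ennreal" where
  "maxplus g x = (SUP h\<in>{0<..}. (1 / ennreal h) * (\<integral>\<^sup>+y\<in>{x..x + h}. g y \<partial>lebesgue))"

definition dual_weight :: "real \<Rightarrow> (real \<Rightarrow> real) \<Rightarrow> real \<Rightarrow> ennreal" where
  "dual_weight p w x = ennreal (w x) epowr (- 1 / (p - 1))"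

definition Ap_plus_const :: "real \<Rightarrow> (real \<Rightarrow> real) \<Rightarrow> ennreal" where
  "Ap_plus_const p w =
    (SUP (a, b, c)\<in>{(a, b, c). a < b \<and> b < c}.
      (1 / ennreal (c - a)) * (\<integral>\<^sup>+x\<in>{a..b}. ennreal (w x) \<partial>lebesgue) *
      ((1 / ennreal (c - a)) * (\<integral>\<^sup>+x\<in>{b..c}. dual_weight p w x \<partial>lebesgue)) epowr (p - 1))"

definition Ap_plus :: "real \<Rightarrow> (real \<Rightarrow> real) set" where
  "Ap_plus p = {w. weight w \<and> Ap_plus_const p w < \<infinity>}"

text \<open>
  Intervals with \<open>\<sigma>(a,b) = 0\<close> or \<open>\<sigma>(a,b) = \<infinity>\<close> contribute \<open>0\<close> to the supremum, i.e. it is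
  taken over the intervals on which the quotient is defined.
\<close>

definition Ainf_minus_const :: "(real \<Rightarrow> ennreal) \<Rightarrow> ennreal" where
  "Ainf_minus_const s =
    (SUP (a, b)\<in>{(a, b). a < b}.
      (1 / (\<integral>\<^sup>+x\<in>{a<..<b}. s x \<partial>lebesgue)) *
      (\<integral>\<^sup>+x\<in>{a..b}. maxplus (\<lambda>y. s y * indicator {a<..<b} y) x \<partial>lebesgue))"

end

theory Submission
  imports Defs
begin

text \<open>
  Write \<open>\<sigma>\<close> for the dual weight. The theorem is the combination of a testing estimate and of the fact that
  testing suffices. For an interval \<open>I\<close>, testing with constant \<open>K\<close> means
  \<open>\<integral>\<^sub>I M\<^sup>+(\<sigma>\<chi>\<^sub>I)\<^sup>p w \<le> K \<sigma>(I)\<close>. It holds both with \<open>K \<simeq> [w] [\<sigma>]\<close> and with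
  \<open>K \<simeq> [w]\<^sup>p\<^sup>'\<close>, where \<open>p' = p / (p - 1)\<close>; since the strong type follows with constant
  \<open>C K\<close> for the \<open>p\<close>-th powers, taking \<open>p\<close>-th roots gives the two inequalities.

  Testing is proved on level sets. Let \<open>s \<le> \<sigma>\<close> and let \<open>(l,r)\<close> be a component of a level set \<open>{M\<^sup>+s > \<lambda>}\<close>. By the rising
  sun argument the mean of \<open>s\<close> over \<open>(y,r)\<close> is at least \<open>\<lambda>\<close> for every \<open>y\<close> in the component. The one-sided
  condition compares the weight of an interval only with \<open>\<sigma>\<close> further to the right; applying it to the
  triples \<open>y < (y + r) / 2 < r\<close> and summing over repeated halvings of the distance to \<open>r\<close> gives the
  estimate \<open>\<lambda>\<^sup>p\<^sup>-\<^sup>1 w(l,r) \<le> 2\<^sup>p [w] (r - l)\<close>, in which the gap has disappeared. Summing over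
  dyadic \<open>\<lambda>\<close> yields \<open>\<integral>\<^sub>I (M\<^sup>+s)\<^sup>p w \<le> C [w] \<integral>\<^sub>I M\<^sup>+s\<close> (\<open>weighted_maxplus_le_unweighted\<close>). For
  \<open>s = \<sigma>\<chi>\<^sub>I\<close> the right-hand side is at most \<open>C [w] [\<sigma>] \<sigma>(I)\<close> by definition of \<open>[\<sigma>]\<close>. It is also at
  most \<open>C [w]\<^sup>p\<^sup>' \<sigma>(I)\<close>: pointwise \<open>m \<le> k\<^sup>1\<^sup>/\<^sup>(\<^sup>p\<^sup>-\<^sup>1\<^sup>) \<sigma> + m\<^sup>p w / k\<close>, and for \<open>k = 2 C [w]\<close> the integral of
  the last term is at most half of \<open>\<integral>\<^sub>I m\<close> for \<open>m = M\<^sup>+s\<close>, so that it can be absorbed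
  (\<open>maxplus_dual_weight_le\<close>).

  To see that testing suffices, write \<open>\<bar>f\<bar> = \<phi>\<sigma>\<close>. The average of \<open>\<bar>f\<bar>\<close> over \<open>(x,z)\<close> is the product of the
  \<open>\<sigma>\<close>-average of \<open>\<phi>\<close> and of the Lebesgue average of \<open>\<sigma>\<close>. Let \<open>U\<^sub>k\<close> be the union of the intervals on which
  the \<open>\<sigma>\<close>-average of \<open>\<phi>\<close> exceeds \<open>2\<^sup>k\<close>. If that average over \<open>(x,z)\<close> lies between \<open>2\<^sup>k\<close> and \<open>2\<^sup>k\<^sup>+\<^sup>1\<close>,
  then \<open>(x,z)\<close> lies in one component \<open>J\<close> of \<open>U\<^sub>k\<close>, and the average of \<open>\<bar>f\<bar>\<close> is at most
  \<open>2\<^sup>k\<^sup>+\<^sup>1 M\<^sup>+(\<sigma>\<chi>\<^sub>J)(x)\<close>. Replacing the supremum by the sum over all \<open>k\<close> and \<open>J\<close> and testing on each \<open>J\<close>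
  leaves \<open>K \<Sum>\<^sub>k 2\<^sup>(\<^sup>k\<^sup>+\<^sup>1\<^sup>)\<^sup>p \<sigma>(U\<^sub>k)\<close>, which is bounded by a multiple of
  \<open>\<integral> \<phi>\<^sup>p \<sigma> = \<integral> \<bar>f\<bar>\<^sup>p w\<close> because the uncentred maximal
  operator with respect to any measure on the line is of weak type \<open>(1,1)\<close>
  (\<open>strong_type_dyadic_sum\<close>, \<open>strong_type_on_window_if_testing\<close>).

  This needs \<open>\<sigma>\<close> to be integrable on the interval in question. Where it is not, the \<open>A\<^sub>p\<^sup>+\<close> condition forces
  \<open>w = 0\<close> almost everywhere to the left, so intervals of finite \<open>\<sigma>\<close>-measure exhaust the part of the line
  that carries the weight (\<open>strong_type_if_testing\<close>).
\<close>

section \<open>Real powers of extended reals and dyadic sums\<close>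

lemma ennreal_one_divide_times_le_iff:
  fixes m M h :: ennreal
  assumes "0 < h" "h < top"
  shows "1 / h * m \<le> M \<longleftrightarrow> m \<le> M * h"
proof -
  have "1 / h * m = m / h"
    by (simp add: ennreal_times_divide mult.commute)
  also have "m / h \<le> M \<longleftrightarrow> m \<le> M * h"
    using assms by (cases m; cases M; cases h)
      (auto simp: divide_ennreal ennreal_mult[symmetric] field_simps ennreal_top_divide ennreal_top_mult top_unique)
  finally show ?thesis .
qed

lemma epowr_pos_exponent:
  assumes "0 < a"
  shows "x epowr a = (if x = \<infinity> then \<infinity> else ennreal (enn2real x powr a))"
  using assms by (auto simp: epowr_def)

lemma epowr_ennreal: "0 < a \<Longrightarrow> 0 \<le> r \<Longrightarrow> ennreal r epowr a = ennreal (r powr a)"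
  by (simp add: epowr_pos_exponent)

lemma epowr_top: "0 < a \<Longrightarrow> top epowr a = top"
  by (simp add: epowr_pos_exponent)

lemma epowr_zero: "0 < a \<Longrightarrow> 0 epowr a = 0"
  by (simp add: epowr_pos_exponent)

lemma epowr_mono:
  assumes "0 < a" "x \<le> y"
  shows "x epowr a \<le> y epowr a"
  using assms
  by (cases x; cases y) (auto simp: epowr_ennreal epowr_top intro: ennreal_leI powr_mono2 simp: top_unique)

lemma epowr_mult:
  assumes "0 < a"
  shows "(x * y) epowr a = x epowr a * y epowr a"
proof (cases "x = 0 \<or> y = 0 \<or> x = top \<or> y = top")
  case True
  then show ?thesis
    using assms by (auto simp: epowr_zero epowr_top ennreal_mult_top ennreal_top_mult epowr_pos_exponent enn2real_eq_0_iff ennreal_eq_0_iff)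
next
  case False
  then show ?thesis using assms
    by (cases x; cases y)
       (auto simp: epowr_ennreal epowr_top ennreal_mult[symmetric] powr_mult)
qed

lemma epowr_epowr:
  assumes "0 < a" "0 < b"
  shows "(x epowr a) epowr b = x epowr (a * b)"
  using assms by (cases x) (auto simp: epowr_ennreal epowr_top powr_powr)

lemma epowr_add:
  assumes "0 < a" "0 < b"
  shows "x epowr (a + b) = x epowr a * x epowr b"
  using assms
  by (cases x) (auto simp: epowr_ennreal epowr_top powr_add ennreal_mult)

lemma epowr_one: "x epowr 1 = x"
  by (cases x) (auto simp: epowr_ennreal epowr_top)

text \<open>
  Raising to a positive power is an order isomorphism of \<open>[0,\<infinity>]\<close>; this form makes it commute with
  suprema and turns pointwise bounds on \<open>p\<close>-th powers into bounds on the maximal operator.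
\<close>

lemma epowr_le_iff:
  assumes "0 < a"
  shows "x epowr a \<le> y \<longleftrightarrow> x \<le> y epowr (1 / a)"
proof
  assume "x epowr a \<le> y"
  then have "(x epowr a) epowr (1 / a) \<le> y epowr (1 / a)"
    using assms by (intro epowr_mono) auto
  then show "x \<le> y epowr (1 / a)" using assms by (simp add: epowr_epowr epowr_one)
next
  assume "x \<le> y epowr (1 / a)"
  then have "x epowr a \<le> (y epowr (1 / a)) epowr a"
    using assms by (intro epowr_mono) auto
  then show "x epowr a \<le> y" using assms by (simp add: epowr_epowr epowr_one)
qed

lemma epowr_SUP:
  assumes "0 < a"
  shows "(SUP i\<in>I. f i) epowr a = (SUP i\<in>I. f i epowr a)"
proof (rule antisym)
  show "(SUP i\<in>I. f i) epowr a \<le> (SUP i\<in>I. f i epowr a)"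
    unfolding epowr_le_iff[OF assms]
    by (rule SUP_least) (auto simp: epowr_le_iff[OF assms, symmetric] intro: SUP_upper)
  show "(SUP i\<in>I. f i epowr a) \<le> (SUP i\<in>I. f i) epowr a"
    using assms by (auto intro!: SUP_least epowr_mono SUP_upper)
qed

lemma epowr_less_top: "0 < a \<Longrightarrow> x < top \<Longrightarrow> x epowr a < top"
  by (cases x) (auto simp: epowr_ennreal)

lemma epowr_measurable [measurable]:
  assumes [measurable]: "f \<in> borel_measurable M"
  shows "(\<lambda>x. f x epowr a) \<in> borel_measurable M"
  unfolding epowr_def by measurable

lemma le_one_plus_epowr:
  assumes "1 \<le> p"
  shows "t \<le> 1 + t epowr p"
proof (cases "t \<le> 1")
  case True
  then show ?thesis by (simp add: add_increasing2)
next
  case False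
  have "t epowr 1 \<le> t epowr p"
  proof (cases t)
    case (real r)
    then have "1 \<le> r" using False by (cases "1 \<le> r") (auto simp: ennreal_le_1)
    then show ?thesis using assms real powr_mono[of 1 p r] by (simp add: epowr_ennreal)
  qed (use assms in \<open>simp add: epowr_top\<close>)
  then show ?thesis by (simp add: epowr_one add_increasing)
qed

definition dyadic :: "int \<Rightarrow> ennreal" where
  "dyadic k = ennreal (2 powr real_of_int k)"

lemma dyadic_pos: "0 < dyadic k" and dyadic_less_top: "dyadic k < top"
  by (auto simp: dyadic_def)

lemma dyadic_Suc: "dyadic (k + 1) = 2 * dyadic k"
  unfolding dyadic_def by (subst ennreal_numeral[symmetric], subst ennreal_mult[symmetric]) (auto simp: powr_add)

lemma ex_dyadic_between:
  assumes "0 < y" "y < top"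
  shows "\<exists>k. dyadic k < y \<and> y \<le> dyadic (k + 1)"
proof -
  obtain r where r: "y = ennreal r" "0 < r"
    using assms by (cases y) auto
  define k where "k = \<lceil>log 2 r\<rceil> - 1"
  have "real_of_int k < log 2 r" "log 2 r \<le> real_of_int (k + 1)"
    unfolding k_def by linarith+
  then have "2 powr real_of_int k < r" "r \<le> 2 powr real_of_int (k + 1)"
    using r by (auto simp: less_log_iff log_le_iff)
  then show ?thesis
    using r by (auto simp: dyadic_def ennreal_less_iff intro!: exI[of _ k] ennreal_leI)
qed

text \<open>
  The sum is a geometric series that starts at the largest dyadic number below \<open>y\<close> and runs downwards,
  hence is comparable to its first term.
\<close>

lemma dyadic_geometric_sum:
  assumes q: "0 < q"
  shows "(\<integral>\<^sup>+k. (if dyadic k \<le> y then dyadic k epowr q else 0) \<partial>count_space UNIV)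
    \<le> ennreal (1 / (1 - 2 powr (- q))) * y epowr q"
proof -
  have z: "2 powr (- q) < 1" using q by (simp add: powr_less_one)
  consider "y = 0" | "y = top" | r where "y = ennreal r" "0 < r"
    by (cases y) (auto, metis ennreal_0 less_eq_real_def)
  then show ?thesis
  proof cases
    case 1
    have "\<not> dyadic k \<le> 0" for k using dyadic_pos[of k] by simp
    then show ?thesis using 1 by simp
  next
    case 2
    then show ?thesis using z q by (simp add: epowr_top ennreal_mult_top ennreal_eq_0_iff not_le)
  next
    case (3 r)
    define n where "n = \<lfloor>log 2 r\<rfloor>"
    have n: "2 powr real_of_int n \<le> r"
      unfolding n_def using 3 by (metis floor_correct le_log_iff one_less_numeral_iff semiring_norm(76))
    have le: "dyadic k \<le> y \<longleftrightarrow> k \<le> n" for k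
    proof -
      have "dyadic k \<le> y \<longleftrightarrow> 2 powr real_of_int k \<le> r"
        using 3 by (simp add: dyadic_def)
      also have "\<dots> \<longleftrightarrow> real_of_int k \<le> log 2 r"
        using 3 by (simp add: le_log_iff)
      also have "\<dots> \<longleftrightarrow> k \<le> n" unfolding n_def by (simp add: le_floor_iff)
      finally show ?thesis .
    qed
    have "(\<integral>\<^sup>+k. (if dyadic k \<le> y then dyadic k epowr q else 0) \<partial>count_space UNIV)
        = (\<integral>\<^sup>+k. dyadic k epowr q \<partial>count_space {..n})"
      by (subst nn_integral_count_space_indicator)
         (auto simp: le intro!: nn_integral_cong split: split_indicator)
    also have "\<dots> = (\<integral>\<^sup>+j. dyadic (n - int j) epowr q \<partial>count_space UNIV)"
    proof (rule nn_integral_bij_count_space[symmetric])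
      show "bij_betw (\<lambda>j::nat. n - int j) UNIV {..n}"
        by (rule bij_betwI[of _ _ _ "\<lambda>k. nat (n - k)"]) auto
    qed
    also have "\<dots> = (\<Sum>j. dyadic (n - int j) epowr q)"
      by (rule nn_integral_count_space_nat)
    also have "\<dots> = (\<Sum>j. ennreal (2 powr (real_of_int n * q) * (2 powr (-q)) ^ j))"
    proof (rule suminf_cong)
      fix j
      have "(2 powr real_of_int (n - int j)) powr q = 2 powr (real_of_int n * q) * (2 powr (-q)) ^ j"
        by (simp add: powr_powr powr_add[symmetric] powr_realpow[symmetric] algebra_simps)
      then show "dyadic (n - int j) epowr q = ennreal (2 powr (real_of_int n * q) * (2 powr (-q)) ^ j)"
        using q by (simp add: dyadic_def epowr_ennreal)
    qed
    also have "\<dots> = ennreal (\<Sum>j. 2 powr (real_of_int n * q) * (2 powr (-q)) ^ j)"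
      using z by (intro suminf_ennreal2 summable_mult summable_geometric) auto
    also have "\<dots> = ennreal (2 powr (real_of_int n * q) * (1 / (1 - 2 powr (- q))))"
      using z by (subst suminf_mult) (auto intro: summable_geometric simp: suminf_geometric)
    also have "\<dots> \<le> ennreal (1 / (1 - 2 powr (- q))) * y epowr q"
    proof -
      have "2 powr (real_of_int n * q) = (2 powr real_of_int n) powr q"
        by (simp add: powr_powr)
      also have "\<dots> \<le> r powr q" using n q by (intro powr_mono2) auto
      finally show ?thesis
        using 3 q z by (simp add: epowr_ennreal ennreal_mult[symmetric] divide_right_mono)
    qed
    finally show ?thesis .
  qed
qed

text \<open>
  Together with \<open>dyadic_geometric_sum\<close> this replaces the layer-cake formula: integrals of powers are
  compared with sums over dyadic levels, which keeps every interchange a countable one.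
\<close>

lemma epowr_le_dyadic_sum:
  assumes q: "0 < q"
  shows "m epowr q \<le> (\<integral>\<^sup>+k. (if dyadic k < m then dyadic (k + 1) epowr q else 0) \<partial>count_space UNIV)"
    (is "_ \<le> ?S")
proof -
  have term_le: "dyadic (k + 1) epowr q \<le> ?S" if "dyadic k < m" for k
    using nn_integral_ge_point[of k UNIV "\<lambda>k. if dyadic k < m then dyadic (k + 1) epowr q else 0"] that
    by simp
  consider "m = 0" | "m = top" | "0 < m" "m < top"
    by (metis less_top zero_less_iff_neq_zero)
  then show ?thesis
  proof cases
    case 1
    then show ?thesis using q by (simp add: epowr_zero)
  next
    case 2
    \<comment> \<open>Every dyadic number occurs in the sum, so the sum is not bounded.\<close>
    have "?S = top"
    proof (rule ccontr)
      assume "?S \<noteq> top"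
      then have "?S < top" by (simp add: less_top)
      then have fin: "?S epowr (1/q) < top" using q by (intro epowr_less_top) auto
      have b: "dyadic (k + 1) \<le> ?S epowr (1/q)" for k
        using term_le[of k] 2 dyadic_less_top[of k] epowr_le_iff[OF q] by simp
      have "0 < ?S epowr (1/q)" using b[of 0] dyadic_pos[of 1] by (simp add: less_le_trans)
      then obtain k where "?S epowr (1/q) \<le> dyadic (k + 1)"
        using ex_dyadic_between fin by blast
      also have "\<dots> < dyadic (k + 1 + 1)"
        by (auto simp: dyadic_def ennreal_less_iff)
      finally show False using b[of "k + 1"] by simp
    qed
    then show ?thesis by simp
  next
    case 3
    then obtain k where "dyadic k < m" "m \<le> dyadic (k + 1)"
      using ex_dyadic_between by blast
    then show ?thesis
      using term_le[of k] epowr_mono[OF q] by (meson order_trans)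
  qed
qed

section \<open>Integrals over sets\<close>

definition mass :: "(real \<Rightarrow> ennreal) \<Rightarrow> real set \<Rightarrow> ennreal" where
  "mass g E = (\<integral>\<^sup>+x\<in>E. g x \<partial>lebesgue)"

lemma sets_lebesgue_open: "open U \<Longrightarrow> U \<in> sets lebesgue"
  by (simp add: borel_open sets_completionI_sets)

lemma sets_lebesgue_interval [measurable]: "{a<..<b::real} \<in> sets lebesgue"
  by (rule sets_lebesgue_open) simp

lemma mass_eq_emeasure:
  "g \<in> borel_measurable lebesgue \<Longrightarrow> E \<in> sets lebesgue \<Longrightarrow> mass g E = emeasure (density lebesgue g) E"
  by (simp add: mass_def emeasure_density)

lemma mass_mono:
  assumes "E \<subseteq> F" "\<And>x. x \<in> E \<Longrightarrow> g x \<le> h x"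
  shows "mass g E \<le> mass h F"
  unfolding mass_def using assms by (intro nn_integral_mono) (auto split: split_indicator)

lemma mass_cong:
  assumes "\<And>x. x \<in> E \<Longrightarrow> g x = h x"
  shows "mass g E = mass h E"
  unfolding mass_def using assms by (intro nn_integral_cong) (auto split: split_indicator)

lemma mass_cong_AE:
  assumes "AE x in lebesgue. x \<in> E \<longleftrightarrow> x \<in> F"
  shows "mass g E = mass g F"
  unfolding mass_def using assms
  by (intro nn_integral_cong_AE) (auto elim!: eventually_mono split: split_indicator)

lemma AE_lebesgue_neq: "AE x in lebesgue. x \<noteq> (c::real)"
  by (rule AE_I'[of "{c}"]) auto

lemma mass_closed_interval: "mass g {a..b} = mass g {a<..<b}"
  by (rule mass_cong_AE)
     (use AE_lebesgue_neq[of a] AE_lebesgue_neq[of b] in eventually_elim, auto)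

lemma mass_right_closed: "mass g {a<..b} = mass g {a<..<b}"
  by (rule mass_cong_AE)
     (use AE_lebesgue_neq[of b] in eventually_elim, auto)

lemma mass_left_closed: "mass g {a..<b} = mass g {a<..<b}"
  by (rule mass_cong_AE)
     (use AE_lebesgue_neq[of a] in eventually_elim, auto)

lemma mass_Un:
  assumes "g \<in> borel_measurable lebesgue" "E \<in> sets lebesgue" "F \<in> sets lebesgue" "E \<inter> F = {}"
  shows "mass g (E \<union> F) = mass g E + mass g F"
  using assms by (simp add: mass_eq_emeasure plus_emeasure)

lemma mass_split:
  assumes "g \<in> borel_measurable lebesgue" "a \<le> b" "b \<le> c"
  shows "mass g {a<..<c} = mass g {a<..<b} + mass g {b<..<c}"
proof (cases "b < c")
  case True
  have "mass g {a<..<c} = mass g ({a<..b} \<union> {b<..<c})"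
    using assms True by (intro arg_cong[where f="mass g"]) auto
  also have "\<dots> = mass g {a<..b} + mass g {b<..<c}"
    using assms by (intro mass_Un) auto
  finally show ?thesis by (simp add: mass_right_closed)
next
  case False
  then show ?thesis using assms by (simp add: mass_def)
qed

lemma mass_const: "a \<le> b \<Longrightarrow> mass (\<lambda>_. c) {a<..<b} = c * ennreal (b - a)"
  by (simp add: mass_def nn_integral_cmult_indicator)

lemma mass_cmult: "g \<in> borel_measurable lebesgue \<Longrightarrow> E \<in> sets lebesgue \<Longrightarrow> mass (\<lambda>x. c * g x) E = c * mass g E"
  unfolding mass_def by (simp add: mult.assoc nn_integral_cmult)

lemma mass_add:
  "g \<in> borel_measurable lebesgue \<Longrightarrow> h \<in> borel_measurable lebesgue \<Longrightarrow> E \<in> sets lebesgue \<Longrightarrow>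
    mass (\<lambda>x. g x + h x) E = mass g E + mass h E"
  unfolding mass_def by (simp add: distrib_right nn_integral_add)

lemma mass_times_null:
  assumes "u \<in> borel_measurable lebesgue" "E \<in> sets lebesgue" "mass u E = 0"
  shows "mass (\<lambda>x. v x * u x) E = 0"
proof -
  have "AE x in lebesgue. u x * indicator E x = 0"
    using assms by (subst nn_integral_0_iff_AE[symmetric]) (auto simp: mass_def)
  then have "AE x in lebesgue. v x * u x * indicator E x = 0"
    by eventually_elim (simp add: mult.assoc)
  from nn_integral_cong_AE[OF this] show ?thesis by (simp add: mass_def)
qed

lemma mass_SUP_sets:
  assumes "g \<in> borel_measurable lebesgue" "incseq E" "\<And>n::nat. E n \<in> sets lebesgue"
  shows "mass g (\<Union>n. E n) = (SUP n. mass g (E n))"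
  using assms by (simp add: mass_eq_emeasure sets.countable_UN SUP_emeasure_incseq image_subset_iff)

lemma mass_monotone_convergence:
  assumes "\<And>n::nat. s n \<in> borel_measurable lebesgue" "E \<in> sets lebesgue" "\<And>x. incseq (\<lambda>n. s n x)"
  shows "mass (\<lambda>x. SUP n. s n x) E = (SUP n. mass (s n) E)"
proof -
  have [measurable]: "E \<in> sets lebesgue" "\<And>n::nat. s n \<in> borel_measurable lebesgue" using assms by auto
  have "mass (\<lambda>x. SUP n. s n x) E = (\<integral>\<^sup>+x. (SUP n. s n x * indicator E x) \<partial>lebesgue)"
    unfolding mass_def by (intro nn_integral_cong) (auto split: split_indicator simp: SUP_mult_right_ennreal)
  also have "\<dots> = (SUP n. mass (s n) E)"
    unfolding mass_def using assms(3)
    by (intro nn_integral_monotone_convergence_SUP)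
       (auto simp: incseq_def le_fun_def split: split_indicator)
  finally show ?thesis .
qed

lemma borel_measurable_nn_integral_count_space:
  fixes f :: "'i \<Rightarrow> 'a \<Rightarrow> ennreal"
  assumes "countable I" and "\<And>i. i \<in> I \<Longrightarrow> f i \<in> borel_measurable M"
  shows "(\<lambda>x. \<integral>\<^sup>+i. f i x \<partial>count_space I) \<in> borel_measurable M"
proof -
  have "(\<lambda>(i, x). f i x) \<in> borel_measurable (count_space I \<Otimes>\<^sub>M M)"
    using assms by (intro measurable_pair_measure_countable1) auto
  then have "(\<lambda>(x, i). f i x) \<in> borel_measurable (M \<Otimes>\<^sub>M count_space I)"
    by (subst measurable_pair_swap_iff) (simp add: case_prod_unfold)
  then show ?thesis
    using sigma_finite_measure.borel_measurable_nn_integral[OF sigma_finite_measure_count_space_countable[OF assms(1)]]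
    by (simp add: case_prod_unfold)
qed

lemma countable_components_open:
  fixes U :: "real set"
  assumes "open U"
  shows "countable (components U)"
proof (rule countable_disjoint_open_subsets)
  show "open J" if "J \<in> components U" for J using open_components[OF assms that] .
  show "disjoint (components U)" using pairwise_disjoint_components[of U] by (simp add: pairwise_def disjnt_def)
qed

lemma bounded_component_interval:
  fixes U :: "real set"
  assumes "open U" "bounded U" "J \<in> components U"
  obtains a b where "a < b" "J = {a<..<b}" "a \<notin> U" "b \<notin> U"
proof -
  have J: "open J" "connected J" "J \<noteq> {}" "J \<subseteq> U"
    using open_components[OF assms(1,3)] in_components_connected[OF assms(3)]
      in_components_nonempty[OF assms(3)] in_components_subset[OF assms(3)] by simp_all
  have bd: "bounded J" using bounded_subset[OF assms(2) J(4)] .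
  then have bdd: "bdd_below J" "bdd_above J" by (auto simp: bounded_imp_bdd_below bounded_imp_bdd_above)
  define a b where "a = Inf J" and "b = Sup J"
  have "a \<notin> J"
  proof
    assume "a \<in> J"
    then obtain e where "0 < e" "ball a e \<subseteq> J" using J(1) by (auto simp: open_contains_ball)
    then have "a - e/2 \<in> J" by (auto simp: dist_real_def subset_iff)
    then have "a \<le> a - e/2" unfolding a_def using bdd by (intro cInf_lower) auto
    then show False using \<open>0 < e\<close> by simp
  qed
  have "b \<notin> J"
  proof
    assume "b \<in> J"
    then obtain e where "0 < e" "ball b e \<subseteq> J" using J(1) by (auto simp: open_contains_ball)
    then have "b + e/2 \<in> J" by (auto simp: dist_real_def subset_iff)
    then have "b + e/2 \<le> b" unfolding b_def using bdd by (intro cSup_upper) auto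
    then show False using \<open>0 < e\<close> by simp
  qed
  have eq: "J = {a<..<b}"
  proof (intro set_eqI iffI)
    fix x assume "x \<in> J"
    then have "a \<le> x" "x \<le> b" unfolding a_def b_def using bdd by (auto intro: cInf_lower cSup_upper)
    then show "x \<in> {a<..<b}" using \<open>x \<in> J\<close> \<open>a \<notin> J\<close> \<open>b \<notin> J\<close>
      by (metis greaterThanLessThan_iff order_le_less)
  next
    fix x assume x: "x \<in> {a<..<b}"
    obtain y where "y \<in> J" "y < x" using x J(3) cInf_lessD[of J x] by (auto simp: a_def)
    moreover obtain z where "z \<in> J" "x < z" using x J(3) less_cSupD[of J x] by (auto simp: b_def)
    ultimately show "x \<in> J" using connected_contains_Icc[OF J(2)] by (meson atLeastAtMost_iff less_imp_le subset_iff)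
  qed
  have "a < b" using J(3) eq by auto
  have out: "c \<notin> U" if "c = a \<or> c = b" for c
  proof
    assume "c \<in> U"
    have "connected (insert c J)"
      by (rule connected_intermediate_closure[of J]) (use J that eq \<open>a < b\<close> in auto)
    moreover have "insert c J \<subseteq> U" using \<open>c \<in> U\<close> J by auto
    ultimately have "insert c J \<subseteq> J"
      using components_maximal[OF assms(3), of "insert c J"] J(3) by auto
    then show False using that \<open>a \<notin> J\<close> \<open>b \<notin> J\<close> by auto
  qed
  show ?thesis using that[OF \<open>a < b\<close> eq] out by auto
qed

lemma mass_components:
  assumes "g \<in> borel_measurable lebesgue" "open U"
  shows "mass g U = (\<integral>\<^sup>+J. mass g J \<partial>count_space (components U))"
proof -
  have s: "J \<in> sets lebesgue" if "J \<in> components U" for J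
    using open_components[OF assms(2) that] by (rule sets_lebesgue_open)
  have "emeasure (density lebesgue g) (\<Union>(id ` components U))
      = (\<integral>\<^sup>+J. emeasure (density lebesgue g) (id J) \<partial>count_space (components U))"
    using s countable_components_open[OF assms(2)] pairwise_disjoint_components[of U]
    by (intro emeasure_UN_countable) (auto simp: disjoint_family_on_def pairwise_def disjnt_def)
  also have "\<dots> = (\<integral>\<^sup>+J. mass g J \<partial>count_space (components U))"
    using assms s by (intro nn_integral_cong) (simp add: mass_eq_emeasure)
  finally show ?thesis
    using assms by (simp add: mass_eq_emeasure sets_lebesgue_open)
qed

lemma mass_le_if_components_le:
  assumes "u \<in> borel_measurable lebesgue" "v \<in> borel_measurable lebesgue" "open U"
    and "\<And>J. J \<in> components U \<Longrightarrow> mass u J * c \<le> d * mass v J"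
  shows "mass u U * c \<le> d * mass v U"
proof -
  have "mass u U * c = (\<integral>\<^sup>+J. mass u J * c \<partial>count_space (components U))"
    using assms by (simp add: mass_components nn_integral_multc)
  also have "\<dots> \<le> (\<integral>\<^sup>+J. d * mass v J \<partial>count_space (components U))"
    using assms by (intro nn_integral_mono) auto
  also have "\<dots> = d * mass v U"
    using assms by (simp add: mass_components nn_integral_cmult)
  finally show ?thesis .
qed

text \<open>
  Source of the lower semicontinuity of the maximal operator: the reserve \<open>d\<close> on both sides is the amount
  by which the interval may be translated.
\<close>

lemma mass_less_interior:
  assumes g: "g \<in> borel_measurable lebesgue" and c: "c < mass g {x<..<z}"
  obtains d where "0 < d" "c < mass g {x + d<..<z - d}"
proof -
  define E where "E n = {x + 1 / Suc n<..<z - 1 / Suc n}" for n :: nat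
  have le: "1 / real (Suc n) \<le> 1 / real (Suc m)" if "m \<le> n" for m n
    using that by (simp add: frac_le)
  have inc: "incseq E"
    unfolding incseq_def E_def using le by (fastforce intro: order.strict_trans1 order.strict_trans2)
  have "(\<Union>n. E n) = {x<..<z}"
  proof (intro set_eqI iffI)
    fix y assume "y \<in> {x<..<z}"
    then have "0 < min (y - x) (z - y)" by auto
    then obtain n where "1 / real (Suc n) < min (y - x) (z - y)" using nat_approx_posE by metis
    then show "y \<in> (\<Union>n. E n)" by (auto simp: E_def intro!: exI[of _ n])
  next
    fix y assume "y \<in> (\<Union>n. E n)"
    then obtain n where n: "x + 1 / Suc n < y" "y < z - 1 / Suc n" by (auto simp: E_def)
    have "0 < 1 / real (Suc n)" by simp
    then have "x < y" "y < z" using n by linarith+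
    then show "y \<in> {x<..<z}" by simp
  qed
  then have "c < (SUP n. mass g (E n))"
    using mass_SUP_sets[OF g inc] c by (simp add: E_def)
  then obtain n where "c < mass g (E n)" by (auto simp: less_SUP_iff)
  then show ?thesis by (intro that[of "1 / Suc n"]) (auto simp: E_def)
qed

text \<open>
  Used to put the left end point of an interval into the interior of a slightly larger one.
\<close>

lemma mass_less_enlarge_left:
  assumes g: "g \<in> borel_measurable lebesgue" and fin: "mass g {a<..<b} < \<infinity>"
    and ax: "a < x" and t: "mass g {x<..<b} < t"
  obtains y where "a < y" "y < x" "mass g {y<..<b} < t"
proof -
  define E where "E n = {max a (x - 1 / Suc n)<..<b}" for n :: nat
  have le: "1 / real (Suc n) \<le> 1 / real (Suc m)" if "m \<le> n" for m n
    using that by (simp add: frac_le)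
  have dec: "decseq E"
  proof (unfold decseq_def E_def, intro allI impI)
    fix m n :: nat assume "m \<le> n"
    from le[OF this] have "max a (x - 1 / Suc m) \<le> max a (x - 1 / Suc n)" by linarith
    then show "{max a (x - 1 / real (Suc n))<..<b} \<subseteq> {max a (x - 1 / real (Suc m))<..<b}"
      by (auto simp: subset_iff)
  qed
  have int: "(\<Inter>n. E n) = {x..<b}"
  proof (intro set_eqI iffI)
    fix y assume y: "y \<in> (\<Inter>n. E n)"
    have "x \<le> y"
    proof (rule ccontr)
      assume "\<not> x \<le> y"
      then have "0 < x - y" by simp
      then obtain n where "1 / real (Suc n) < x - y" using nat_approx_posE by metis
      moreover have "y \<in> E n" using y by auto
      ultimately show False by (auto simp: E_def)
    qed
    then show "y \<in> {x..<b}" using y by (auto simp: E_def)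
  next
    fix y assume y: "y \<in> {x..<b}"
    show "y \<in> (\<Inter>n. E n)"
    proof
      fix n :: nat
      have "0 < 1 / real (Suc n)" by simp
      then have "x - 1 / real (Suc n) < y" using y unfolding atLeastLessThan_iff by linarith
      then show "y \<in> E n" using y ax by (simp add: E_def)
    qed
  qed
  have "(INF n. emeasure (density lebesgue g) (E n)) = emeasure (density lebesgue g) (\<Inter>n. E n)"
  proof (rule INF_emeasure_decseq[OF _ dec])
    show "range E \<subseteq> sets (density lebesgue g)" by (auto simp: E_def)
    fix n
    have "emeasure (density lebesgue g) (E n) \<le> emeasure (density lebesgue g) {a<..<b}"
      by (intro emeasure_mono) (auto simp: E_def)
    also have "\<dots> < \<infinity>" using fin g by (simp add: mass_eq_emeasure)
    finally show "emeasure (density lebesgue g) (E n) \<noteq> \<infinity>" by simp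
  qed
  then have "(INF n. mass g (E n)) = mass g {x..<b}"
    using g unfolding int by (simp add: mass_eq_emeasure E_def)
  then have "(INF n. mass g (E n)) < t" using t by (simp add: mass_left_closed)
  then obtain n where n: "mass g (E n) < t" by (auto simp: INF_less_iff)
  define y where "y = (max a (x - 1 / Suc n) + x) / 2"
  have y: "max a (x - 1 / Suc n) < y" "y < x" using ax by (auto simp: y_def field_simps)
  have "mass g {y<..<b} \<le> mass g (E n)" using y by (intro mass_mono) (auto simp: E_def)
  then show ?thesis using y n by (intro that[of y]) auto
qed

section \<open>The one-sided maximal operator\<close>

text \<open>
  Characterisation without division, through which all later arguments see the maximal operator.
\<close>

lemma maxplus_le_iff:
  "maxplus g x \<le> M \<longleftrightarrow> (\<forall>z>x. mass g {x<..<z} \<le> M * ennreal (z - x))"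
proof -
  have *: "1 / ennreal h * m \<le> M \<longleftrightarrow> m \<le> M * ennreal h" if "0 < h" for h m
    using that by (intro ennreal_one_divide_times_le_iff) auto
  have "maxplus g x \<le> M \<longleftrightarrow> (\<forall>h>0. mass g {x<..<x + h} \<le> M * ennreal h)"
    unfolding maxplus_def mass_def[symmetric] SUP_le_iff mass_closed_interval using * by auto
  also have "\<dots> \<longleftrightarrow> (\<forall>z>x. mass g {x<..<z} \<le> M * ennreal (z - x))"
    (is "?L \<longleftrightarrow> ?R")
  proof
    assume L: ?L
    show ?R
    proof (intro allI impI)
      fix z assume "z > x"
      then show "mass g {x<..<z} \<le> M * ennreal (z - x)" using L[rule_format, of "z - x"] by simp
    qed
  next
    assume R: ?R
    show ?L
    proof (intro allI impI)
      fix h :: real assume "h > 0"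
      then show "mass g {x<..<x + h} \<le> M * ennreal h" using R[rule_format, of "x + h"] by simp
    qed
  qed
  finally show ?thesis .
qed

lemma less_maxplus_iff: "c < maxplus g x \<longleftrightarrow> (\<exists>z>x. c * ennreal (z - x) < mass g {x<..<z})"
  using maxplus_le_iff[of g x c] by (auto simp: not_le[symmetric])

lemma mass_le_maxplus: "x < z \<Longrightarrow> mass g {x<..<z} \<le> maxplus g x * ennreal (z - x)"
  using maxplus_le_iff[of g x "maxplus g x"] by auto

lemma maxplus_mono:
  assumes "\<And>y. g y \<le> h y"
  shows "maxplus g x \<le> maxplus h x"
  unfolding maxplus_le_iff
  by (intro allI impI order_trans[OF mass_mono mass_le_maxplus] assms) auto

lemma maxplus_cong_mass:
  assumes "\<And>z. mass g {x<..<z} = mass h {x<..<z}"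
  shows "maxplus g x = maxplus h x"
  unfolding maxplus_def mass_def[symmetric] mass_closed_interval assms ..

lemma maxplus_cong_AE:
  assumes "AE y in lebesgue. g y = h y"
  shows "maxplus g x = maxplus h x"
  by (rule maxplus_cong_mass, unfold mass_def, rule nn_integral_cong_AE) (use assms in eventually_elim, simp)

text \<open>
  A slightly shortened interval still carries enough mass, by monotone convergence, and it is contained in all
  small translates of the original one; so near \<open>x\<close> the same length of interval works.
\<close>

lemma open_maxplus_greater:
  assumes g: "g \<in> borel_measurable lebesgue"
  shows "open {x. c < maxplus g x}"
  unfolding open_contains_ball
proof (intro ballI)
  fix x assume "x \<in> {x. c < maxplus g x}"
  then obtain z where z: "x < z" "c * ennreal (z - x) < mass g {x<..<z}"
    by (auto simp: less_maxplus_iff)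
  obtain d where d: "0 < d" "c * ennreal (z - x) < mass g {x + d<..<z - d}"
    using mass_less_interior[OF g z(2)] .
  have "c < maxplus g y" if "dist x y < d" for y
    unfolding less_maxplus_iff
  proof (intro exI[of _ "y + (z - x)"] conjI)
    have "mass g {x + d<..<z - d} \<le> mass g {y<..<y + (z - x)}"
      using that by (intro mass_mono) (auto simp: dist_real_def)
    then show "c * ennreal (y + (z - x) - y) < mass g {y<..<y + (z - x)}" using d by simp
  qed (use z in auto)
  then show "\<exists>e>0. ball x e \<subseteq> {x. c < maxplus g x}" using d by (auto intro!: exI[of _ d])
qed

lemma maxplus_measurable:
  assumes "g \<in> borel_measurable lebesgue"
  shows "maxplus g \<in> borel_measurable lebesgue"
  by (rule borel_measurableI_greater)
     (simp add: sets_lebesgue_open open_maxplus_greater assms)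

lemma maxplus_SUP:
  assumes "\<And>n::nat. s n \<in> borel_measurable lebesgue" "\<And>x. incseq (\<lambda>n. s n x)"
  shows "maxplus (\<lambda>x. SUP n. s n x) x = (SUP n. maxplus (s n) x)"
proof (rule antisym)
  show "maxplus (\<lambda>x. SUP n. s n x) x \<le> (SUP n. maxplus (s n) x)"
    unfolding maxplus_le_iff
  proof (intro allI impI)
    fix z assume "x < z"
    have "mass (\<lambda>x. SUP n. s n x) {x<..<z} = (SUP n. mass (s n) {x<..<z})"
      using assms by (intro mass_monotone_convergence) auto
    also have "\<dots> \<le> (SUP n. maxplus (s n) x) * ennreal (z - x)"
      by (intro SUP_least order_trans[OF mass_le_maxplus[OF \<open>x < z\<close>]] mult_right_mono SUP_upper) auto
    finally show "mass (\<lambda>x. SUP n. s n x) {x<..<z} \<le> (SUP n. maxplus (s n) x) * ennreal (z - x)" .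
  qed
  show "(SUP n. maxplus (s n) x) \<le> maxplus (\<lambda>x. SUP n. s n x) x"
    by (intro SUP_least maxplus_mono SUP_upper) auto
qed

text \<open>
  Let \<open>c\<close> be the last point of \<open>[y,r]\<close> up to which the mean of \<open>g\<close> from \<open>y\<close> is at least \<open>\<lambda>\<close>. If \<open>c\<close> were
  not \<open>r\<close>, it would lie in the level set, so some \<open>(c,d)\<close> has mean larger than \<open>\<lambda>\<close>. Such \<open>d\<close> cannot be at
  most \<open>r\<close> by the choice of \<open>c\<close>; and if it is beyond \<open>r\<close>, then the part after \<open>r\<close> has mean at most \<open>\<lambda>\<close>
  since \<open>r\<close> is outside the level set, so the part before \<open>r\<close> already has mean larger than \<open>\<lambda>\<close>.
\<close>

lemma rising_sun:
  assumes g: "g \<in> borel_measurable lebesgue" and zero: "\<And>x. b \<le> x \<Longrightarrow> g x = 0"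
    and lam: "0 \<le> lam"
    and J: "{l<..<r} \<in> components ({a<..<b} \<inter> {x. ennreal lam < maxplus g x})"
    and r: "r \<notin> {a<..<b} \<inter> {x. ennreal lam < maxplus g x}" (is "_ \<notin> ?O") and y: "y \<in> {l<..<r}"
  shows "ennreal (lam * (r - y)) \<le> mass g {y<..<r}"
proof -
  have sub: "{l<..<r} \<subseteq> ?O" using J in_components_subset by blast
  then have ab: "{l<..<r} \<subseteq> {a<..<b}" by blast
  have "a \<le> l" "r \<le> b" using ab y by (simp_all add: greaterThanLessThan_subseteq_greaterThanLessThan)
  define Z where "Z = {z \<in> {y..r}. ennreal (lam * (z - y)) \<le> mass g {y<..<z}}"
  define c where "c = Sup Z"
  have yZ: "y \<in> Z" using y by (auto simp: Z_def)
  have bdd: "bdd_above Z" by (rule bdd_aboveI[of _ r]) (auto simp: Z_def)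
  have c: "y \<le> c" "c \<le> r" unfolding c_def using yZ bdd
    by (auto intro!: cSup_upper cSup_least simp: Z_def)
  have cZ: "c \<in> Z"
  proof (rule ccontr)
    assume "c \<notin> Z"
    then have less: "mass g {y<..<c} < ennreal (lam * (c - y))" using c by (auto simp: Z_def)
    then obtain m where m: "mass g {y<..<c} = ennreal m" "0 \<le> m" "m < lam * (c - y)"
      using lam c by (cases "mass g {y<..<c}") (auto simp: ennreal_less_iff)
    then have "0 < lam" using c lam by (cases "lam = 0") auto
    then have "y + m / lam < c" using m by (simp add: field_simps)
    then obtain z where z: "z \<in> Z" "y + m / lam < z" unfolding c_def using less_cSupD[of Z] yZ by blast
    have "z \<le> c" unfolding c_def using z bdd by (intro cSup_upper)
    have "ennreal (lam * (z - y)) \<le> mass g {y<..<z}" using z by (simp add: Z_def)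
    also have "\<dots> \<le> ennreal m" unfolding m(1)[symmetric] using \<open>z \<le> c\<close> by (intro mass_mono) auto
    finally have "lam * (z - y) \<le> m" using m by simp
    then show False using z \<open>0 < lam\<close> by (simp add: field_simps)
  qed
  have "c = r"
  proof (rule ccontr)
    assume "c \<noteq> r"
    then have "c < r" using c by simp
    then have "c \<in> {l<..<r}" using y c by auto
    then have "c \<in> ?O" using sub by blast
    then obtain d where d: "c < d" "ennreal lam * ennreal (d - c) < mass g {c<..<d}"
      by (auto simp: less_maxplus_iff)
    have ext: "z \<notin> Z" if "c < z" for z
      using that bdd unfolding c_def by (meson cSup_upper leD)
    \<comment> \<open>The mean from \<open>y\<close> to \<open>z\<close> would be at least \<open>\<lambda>\<close>, against the choice of \<open>c\<close>.\<close>
    have no: "\<not> ennreal (lam * (z - c)) \<le> mass g {c<..<z}" if z: "c < z" "z \<le> r" for z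
    proof
      assume *: "ennreal (lam * (z - c)) \<le> mass g {c<..<z}"
      have "ennreal (lam * (z - y)) = ennreal (lam * (c - y)) + ennreal (lam * (z - c))"
      proof -
        have "0 \<le> lam * (c - y)" "0 \<le> lam * (z - c)" using lam c z by auto
        then show ?thesis by (subst ennreal_plus[symmetric]) (simp_all add: algebra_simps)
      qed
      also have "\<dots> \<le> mass g {y<..<c} + mass g {c<..<z}"
        using * cZ by (intro add_mono) (auto simp: Z_def)
      also have "\<dots> = mass g {y<..<z}" using g c z by (intro mass_split[symmetric]) auto
      finally show False using ext[OF z(1)] z c by (auto simp: Z_def)
    qed
    show False
    proof (cases "d \<le> r")
      case True
      then show False using no[of d] d lam by (auto simp: ennreal_mult)
    next
      case False
      have "mass g {r<..<d} \<le> ennreal lam * ennreal (d - r)"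
      proof (cases "r = b")
        case True
        have "mass g {r<..<d} = mass (\<lambda>_. 0) {r<..<d}" by (rule mass_cong) (use zero True in auto)
        then show ?thesis by (simp add: mass_def)
      next
        case F: False
        then have "r \<in> {a<..<b}" using \<open>r \<le> b\<close> \<open>a \<le> l\<close> y by auto
        then have "maxplus g r \<le> ennreal lam" using r by auto
        then show ?thesis using False by (auto simp: maxplus_le_iff)
      qed
      moreover have "mass g {c<..<r} \<le> ennreal lam * ennreal (r - c)"
        using no[of r] \<open>c < r\<close> lam by (auto simp: ennreal_mult)
      ultimately have "mass g {c<..<d} \<le> ennreal lam * ennreal (r - c) + ennreal lam * ennreal (d - r)"
        using g False \<open>c < r\<close> by (subst mass_split[of g c r d]) (auto intro: add_mono)
      also have "\<dots> = ennreal lam * ennreal (d - c)"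
        using False \<open>c < r\<close> by (simp add: distrib_left[symmetric] ennreal_plus[symmetric] del: ennreal_plus)
      finally show False using d by simp
    qed
  qed
  then show ?thesis using cZ by (simp add: Z_def)
qed

section \<open>The weight of level sets\<close>

lemma dual_weight_measurable:
  assumes "weight w"
  shows "dual_weight p w \<in> borel_measurable lebesgue"
proof -
  have [measurable]: "w \<in> borel_measurable lebesgue" using assms by (simp add: weight_def)
  show ?thesis unfolding dual_weight_def[abs_def] by measurable
qed

lemma weight_measurable: "weight w \<Longrightarrow> (\<lambda>x. ennreal (w x)) \<in> borel_measurable lebesgue"
  by (auto simp: weight_def)

lemma Ap_plus_interval:
  assumes p: "1 < p" and "a < b" "b < c"
  shows "mass (\<lambda>x. ennreal (w x)) {a<..<b} * mass (dual_weight p w) {b<..<c} epowr (p - 1)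
    \<le> Ap_plus_const p w * ennreal (c - a) epowr p"
proof -
  define l where "l = c - a"
  have l: "0 < l" using assms by (simp add: l_def)
  define W where "W = mass (\<lambda>x. ennreal (w x)) {a<..<b}"
  define S where "S = mass (dual_weight p w) {b<..<c}"
  have "(1 / ennreal l * W) * (1 / ennreal l * S) epowr (p - 1) \<le> Ap_plus_const p w"
    unfolding Ap_plus_const_def W_def S_def l_def mass_def[symmetric] mass_closed_interval
    using assms by (intro SUP_upper2[of "(a, b, c)"]) auto
  then have "(1 / ennreal l * W) * (1 / ennreal l * S) epowr (p - 1) * ennreal l epowr p
      \<le> Ap_plus_const p w * ennreal l epowr p" by (rule mult_right_mono) simp
  moreover have "ennreal l epowr p = ennreal l * ennreal l epowr (p - 1)"
    using epowr_add[of 1 "p - 1" "ennreal l"] p by (simp add: epowr_one)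
  moreover have "(1 / ennreal l * W) * (1 / ennreal l * S) epowr (p - 1) * (ennreal l * ennreal l epowr (p - 1))
     = (ennreal l * (1 / ennreal l) * W) * (ennreal l * (1 / ennreal l) * S) epowr (p - 1)"
    using p by (simp add: epowr_mult ac_simps)
  moreover have "ennreal l * (1 / ennreal l) = 1"
    using l by (simp add: ennreal_times_divide ennreal_divide_self)
  ultimately show ?thesis by (simp add: W_def S_def l_def)
qed

text \<open>
  This removes the gap of the one-sided condition. On \<open>(y,r)\<close> the condition bounds the weight of the left
  half by means of the dual mass of the right half, which is at least \<open>\<lambda>\<close> times its length. The points obtained
  from \<open>l\<close> by repeatedly halving the distance to \<open>r\<close> exhaust the interval, and the bounds add up to a
  multiple of its length.
\<close>

lemma weight_le_length_if_dual_dense: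
  assumes p: "1 < p" and w: "weight w" and lam: "0 < lam" and lr: "l < r"
    and dense: "\<And>y. y \<in> {l<..<r} \<Longrightarrow> ennreal (lam * (r - y)) \<le> mass (dual_weight p w) {y<..<r}"
  shows "mass (\<lambda>x. ennreal (w x)) {l<..<r} * ennreal lam epowr (p - 1)
    \<le> ennreal (2 powr p) * Ap_plus_const p w * ennreal (r - l)"
proof -
  let ?W = "\<lambda>x. ennreal (w x)"
  define L where "L = ennreal lam epowr (p - 1)"
  define K where "K = ennreal (2 powr p) * Ap_plus_const p w"
  note W = weight_measurable[OF w]
  have half: "mass ?W {y<..<(y + r) / 2} * L \<le> K * ennreal ((y + r) / 2 - y)" if y: "l \<le> y" "y < r" for y
  proof -
    define h where "h = (r - y) / 2"
    have h: "0 < h" "(y + r) / 2 - y = h" "r - y = 2 * h" "r - (y + r) / 2 = h"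
      using y by (auto simp: h_def field_simps)
    have "ennreal (lam * h) \<le> mass (dual_weight p w) {(y + r) / 2<..<r}"
      using dense[of "(y + r) / 2"] y h by simp
    then have "mass ?W {y<..<(y + r) / 2} * ennreal (lam * h) epowr (p - 1)
        \<le> mass ?W {y<..<(y + r) / 2} * mass (dual_weight p w) {(y + r) / 2<..<r} epowr (p - 1)"
      using p by (intro mult_left_mono epowr_mono) auto
    also have "\<dots> \<le> Ap_plus_const p w * ennreal (2 * h) epowr p"
      using Ap_plus_interval[OF p, of y "(y + r) / 2" r w] y h by auto
    also have "\<dots> = K * ennreal h * ennreal h epowr (p - 1)"
    proof -
      have "(2 * h) powr p = 2 powr p * h * h powr (p - 1)"
        using h by (simp add: powr_mult powr_diff)
      then have "ennreal (2 * h) epowr p = ennreal (2 powr p) * ennreal h * ennreal h epowr (p - 1)"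
      proof -
        have "ennreal (2 * h) epowr p = ennreal ((2 * h) powr p)"
          using h p by (intro epowr_ennreal) auto
        moreover have "ennreal h epowr (p - 1) = ennreal (h powr (p - 1))"
          using h p by (intro epowr_ennreal) auto
        moreover have "ennreal (2 powr p * h * h powr (p - 1)) = ennreal (2 powr p) * ennreal h * ennreal (h powr (p - 1))"
          using h by (subst ennreal_mult, simp, simp, subst ennreal_mult, simp_all)
        ultimately show ?thesis using \<open>(2 * h) powr p = _\<close> by simp
      qed
      then show ?thesis by (simp add: K_def ac_simps)
    qed
    also have "mass ?W {y<..<(y + r) / 2} * ennreal (lam * h) epowr (p - 1)
        = mass ?W {y<..<(y + r) / 2} * L * ennreal h epowr (p - 1)"
    proof -
      have "ennreal (lam * h) = ennreal lam * ennreal h" using h lam by (intro ennreal_mult) auto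
      then show ?thesis using p by (simp add: L_def epowr_mult mult.assoc)
    qed
    finally have "mass ?W {y<..<(y + r) / 2} * L * ennreal h epowr (p - 1)
        \<le> K * ennreal h * ennreal h epowr (p - 1)" .
    moreover have "ennreal h epowr (p - 1) \<noteq> 0" "ennreal h epowr (p - 1) < top"
      using h p by (auto simp: epowr_ennreal)
    ultimately show ?thesis unfolding h(2)
      using ennreal_mult_le_mult_iff[of "ennreal h epowr (p - 1)" "mass ?W {y<..<(y + r) / 2} * L" "K * ennreal h"]
      by (simp add: mult.commute)
  qed
  \<comment> \<open>The points that halve the distance to \<open>r\<close> again and again.\<close>
  define x where "x n = r - (r - l) / 2 ^ n" for n :: nat
  have x: "l \<le> x n" "x n < r" "x (Suc n) = (x n + r) / 2" for n
  proof -
    have "(r - l) / 2 ^ n \<le> (r - l) / 1" using lr by (intro divide_left_mono) auto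
    then show "l \<le> x n" by (simp add: x_def)
    have "0 < (r - l) / 2 ^ n" using lr by (intro divide_pos_pos) auto
    then show "x n < r" by (simp add: x_def)
    have "(r - l) / 2 ^ Suc n = (r - l) / 2 ^ n / 2" by simp
    moreover have "r - e / 2 = (r - e + r) / 2" for e by argo
    ultimately show "x (Suc n) = (x n + r) / 2" by (simp only: x_def)
  qed
  have ind: "mass ?W {l<..<x n} * L \<le> K * ennreal (x n - l)" for n
  proof (induction n)
    case 0
    then show ?case by (simp add: x_def mass_def)
  next
    case (Suc n)
    have le: "x n \<le> x (Suc n)" unfolding x(3) using x(2)[of n] by argo
    have "mass ?W {l<..<x (Suc n)} * L = mass ?W {l<..<x n} * L + mass ?W {x n<..<x (Suc n)} * L"
      unfolding mass_split[OF W x(1) le] by (rule distrib_right)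
    also have "\<dots> \<le> K * ennreal (x n - l) + K * ennreal (x (Suc n) - x n)"
    proof (rule add_mono[OF Suc])
      show "mass ?W {x n<..<x (Suc n)} * L \<le> K * ennreal (x (Suc n) - x n)"
        unfolding x(3) by (rule half[OF x(1) x(2)])
    qed
    also have "\<dots> = K * ennreal (x (Suc n) - l)"
    proof -
      have "ennreal (x n - l) + ennreal (x (Suc n) - x n) = ennreal ((x n - l) + (x (Suc n) - x n))"
        using x(1)[of n] le by (intro ennreal_plus[symmetric]) (simp_all only: diff_ge_0_iff_ge)
      also have "(x n - l) + (x (Suc n) - x n) = x (Suc n) - l" by simp
      finally show ?thesis by (simp only: distrib_left[symmetric])
    qed
    finally show ?case .
  qed
  have "x n \<le> x (Suc n)" for n unfolding x(3) using x(2)[of n] by argo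
  then have "incseq x" by (rule incseq_SucI)
  have "(\<lambda>n. r - (r - l) * (1/2) ^ n) \<longlonglongrightarrow> r - (r - l) * 0"
    by (intro tendsto_intros LIMSEQ_power_zero) auto
  moreover have "(\<lambda>n. r - (r - l) * (1/2) ^ n) = x"
    by (simp add: fun_eq_iff x_def power_divide)
  ultimately have lim: "x \<longlonglongrightarrow> r" by simp
  have "(\<Union>n. {l<..<x n}) = {l<..<r}"
  proof (intro set_eqI iffI)
    fix z assume "z \<in> {l<..<r}"
    then have "\<forall>\<^sub>F n in sequentially. z < x n" using lim by (intro order_tendstoD) auto
    then obtain n where "z < x n" by (auto simp: eventually_sequentially)
    then show "z \<in> (\<Union>n. {l<..<x n})" using \<open>z \<in> _\<close> by auto
  next
    fix z assume "z \<in> (\<Union>n. {l<..<x n})"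
    then obtain n where "l < z" "z < x n" by auto
    then show "z \<in> {l<..<r}" using x(2)[of n] by auto
  qed
  moreover have "mass ?W (\<Union>n. {l<..<x n}) = (SUP n. mass ?W {l<..<x n})"
  proof (rule mass_SUP_sets[OF W])
    show "incseq (\<lambda>n. {l<..<x n})"
      using incseqD[OF \<open>incseq x\<close>] by (intro monoI subsetI) (auto dest: less_le_trans)
  qed auto
  ultimately have "mass ?W {l<..<r} * L = (SUP n. mass ?W {l<..<x n} * L)"
    by (simp add: SUP_mult_right_ennreal)
  also have "\<dots> \<le> K * ennreal (r - l)"
  proof (rule SUP_least)
    fix n
    show "mass ?W {l<..<x n} * L \<le> K * ennreal (r - l)"
    proof (rule order_trans[OF ind])
      show "K * ennreal (x n - l) \<le> K * ennreal (r - l)"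
        using x(2)[of n] by (intro mult_left_mono ennreal_leI) auto
    qed
  qed
  finally show ?thesis by (simp add: L_def K_def)
qed

lemma weight_of_level_set_le_length:
  assumes p: "1 < p" and w: "weight w" and lam: "0 < lam"
    and s: "s \<in> borel_measurable lebesgue" "\<And>x. s x \<le> dual_weight p w x" "\<And>x. b \<le> x \<Longrightarrow> s x = 0"
  shows "mass (\<lambda>x. ennreal (w x)) ({a<..<b} \<inter> {x. ennreal lam < maxplus s x}) * ennreal lam epowr (p - 1)
    \<le> ennreal (2 powr p) * Ap_plus_const p w * mass (\<lambda>_. 1) ({a<..<b} \<inter> {x. ennreal lam < maxplus s x})"
    (is "mass _ ?O * _ \<le> _ * mass _ ?O")
proof (rule mass_le_if_components_le)
  show O: "open ?O" using open_maxplus_greater[OF s(1)] by (intro open_Int) auto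
  have bd: "bounded ?O" by (rule bounded_subset[of "{a..b}"]) auto
  fix J assume J: "J \<in> components ?O"
  obtain l r where lr: "l < r" "J = {l<..<r}" "r \<notin> ?O"
    using bounded_component_interval[OF O bd J] by metis
  have "ennreal (lam * (r - y)) \<le> mass (dual_weight p w) {y<..<r}" if "y \<in> {l<..<r}" for y
  proof -
    have "ennreal (lam * (r - y)) \<le> mass s {y<..<r}"
      using rising_sun[OF s(1) s(3) _ J[unfolded lr] lr(3) that] lam by auto
    also have "\<dots> \<le> mass (dual_weight p w) {y<..<r}" using s by (intro mass_mono) auto
    finally show ?thesis .
  qed
  from weight_le_length_if_dual_dense[OF p w lam lr(1) this]
  show "mass (\<lambda>x. ennreal (w x)) J * ennreal lam epowr (p - 1)
      \<le> ennreal (2 powr p) * Ap_plus_const p w * mass (\<lambda>_. 1) J"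
    using lr by (simp add: mass_const)
qed (use weight_measurable[OF w] in auto)

text \<open>
  Since the weight of each level set at height \<open>\<lambda>\<close> is at most \<open>2\<^sup>p [w] \<lambda>\<^sup>1\<^sup>-\<^sup>p\<close> times its length, summing
  \<open>\<lambda>\<^sup>p\<close> against the weight costs no more than summing \<open>\<lambda>\<close> against Lebesgue measure. The function \<open>s\<close> will be
  the dual weight cut off to an interval, or a truncation of it.
\<close>

lemma weighted_maxplus_le_unweighted:
  assumes p: "1 < p" and w: "weight w"
    and s: "s \<in> borel_measurable lebesgue" "\<And>x. s x \<le> dual_weight p w x" "\<And>x. b \<le> x \<Longrightarrow> s x = 0"
  shows "mass (\<lambda>x. maxplus s x epowr p * ennreal (w x)) {a<..<b}
    \<le> ennreal (2 * 4 powr p) * Ap_plus_const p w * mass (maxplus s) {a<..<b}"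
proof -
  let ?W = "\<lambda>x. ennreal (w x)" and ?I = "{a<..<b}"
  define K where "K = ennreal (2 powr p) * Ap_plus_const p w"
  define V where "V k = {a<..<b} \<inter> {x. dyadic k < maxplus s x}" for k
  have oV: "open (V k)" for k unfolding V_def using open_maxplus_greater[OF s(1)] by (intro open_Int) auto
  note [measurable] = weight_measurable[OF w] maxplus_measurable[OF s(1)]
  have [measurable]: "?I \<in> sets lebesgue" by simp
  have [measurable]: "V k \<in> sets lebesgue" for k using oV by (rule sets_lebesgue_open)
  have lev: "mass ?W (V k) * dyadic k epowr (p - 1) \<le> K * mass (\<lambda>_. 1) (V k)" for k
    using weight_of_level_set_le_length[OF p w _ s, of "2 powr real_of_int k" b a] by (simp add: V_def dyadic_def K_def)
  have "mass (\<lambda>x. maxplus s x epowr p * ?W x) ?I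
      \<le> (\<integral>\<^sup>+x. (\<integral>\<^sup>+k. dyadic (k + 1) epowr p * (?W x * indicator (V k) x) \<partial>count_space UNIV) \<partial>lebesgue)"
    unfolding mass_def
  proof (intro nn_integral_mono)
    fix x
    have "maxplus s x epowr p * (?W x * indicator ?I x)
        \<le> (\<integral>\<^sup>+k. (if dyadic k < maxplus s x then dyadic (k + 1) epowr p else 0) \<partial>count_space UNIV) * (?W x * indicator ?I x)"
      using p by (intro mult_right_mono epowr_le_dyadic_sum) auto
    also have "\<dots> = (\<integral>\<^sup>+k. (if dyadic k < maxplus s x then dyadic (k + 1) epowr p else 0) * (?W x * indicator ?I x) \<partial>count_space UNIV)"
      by (simp add: nn_integral_multc)
    also have "\<dots> = (\<integral>\<^sup>+k. dyadic (k + 1) epowr p * (?W x * indicator (V k) x) \<partial>count_space UNIV)"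
      by (intro nn_integral_cong) (auto simp: V_def split: split_indicator)
    finally show "maxplus s x epowr p * ?W x * indicator ?I x
        \<le> (\<integral>\<^sup>+k. dyadic (k + 1) epowr p * (?W x * indicator (V k) x) \<partial>count_space UNIV)"
      by (simp add: mult.assoc)
  qed
  also have "\<dots> = (\<integral>\<^sup>+k. dyadic (k + 1) epowr p * mass ?W (V k) \<partial>count_space UNIV)"
    by (subst nn_integral_count_space_nn_integral) (auto simp: mass_def nn_integral_cmult)
  also have "\<dots> \<le> (\<integral>\<^sup>+k. ennreal (2 powr p) * K * (dyadic k * mass (\<lambda>_. 1) (V k)) \<partial>count_space UNIV)"
  proof (intro nn_integral_mono)
    fix k
    have "dyadic (k + 1) epowr p = ennreal (2 powr p) * (dyadic k * dyadic k epowr (p - 1))"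
      using p epowr_add[of 1 "p - 1" "dyadic k"] epowr_ennreal[of p 2]
      by (simp add: dyadic_Suc epowr_mult epowr_one)
    then have "dyadic (k + 1) epowr p * mass ?W (V k)
        = ennreal (2 powr p) * dyadic k * (mass ?W (V k) * dyadic k epowr (p - 1))"
      by (simp add: ac_simps)
    also have "\<dots> \<le> ennreal (2 powr p) * dyadic k * (K * mass (\<lambda>_. 1) (V k))"
      by (intro mult_left_mono lev) auto
    finally show "dyadic (k + 1) epowr p * mass ?W (V k) \<le> ennreal (2 powr p) * K * (dyadic k * mass (\<lambda>_. 1) (V k))"
      by (simp add: ac_simps)
  qed
  also have "\<dots> = ennreal (2 powr p) * K * (\<integral>\<^sup>+k. (\<integral>\<^sup>+x. dyadic k * indicator (V k) x \<partial>lebesgue) \<partial>count_space UNIV)"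
    by (simp add: nn_integral_cmult mass_def)
  also have "\<dots> = ennreal (2 powr p) * K * (\<integral>\<^sup>+x. (\<integral>\<^sup>+k. dyadic k * indicator (V k) x \<partial>count_space UNIV) \<partial>lebesgue)"
    by (subst nn_integral_count_space_nn_integral) auto
  also have "\<dots> \<le> ennreal (2 powr p) * K * (\<integral>\<^sup>+x. 2 * (maxplus s x * indicator ?I x) \<partial>lebesgue)"
  proof (intro mult_left_mono nn_integral_mono)
    fix x
    have "(\<integral>\<^sup>+k. dyadic k * indicator (V k) x \<partial>count_space UNIV)
        \<le> (\<integral>\<^sup>+k. (if dyadic k \<le> maxplus s x then dyadic k epowr 1 else 0) * indicator ?I x \<partial>count_space UNIV)"
      by (intro nn_integral_mono) (auto simp: V_def epowr_one split: split_indicator)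
    also have "\<dots> = (\<integral>\<^sup>+k. (if dyadic k \<le> maxplus s x then dyadic k epowr 1 else 0) \<partial>count_space UNIV) * indicator ?I x"
      by (simp add: nn_integral_multc)
    also have "\<dots> \<le> ennreal (1 / (1 - 2 powr (- 1))) * maxplus s x epowr 1 * indicator ?I x"
      by (intro mult_right_mono dyadic_geometric_sum) auto
    also have "ennreal (1 / (1 - 2 powr (- 1))) = 2" by (simp add: powr_minus)
    finally show "(\<integral>\<^sup>+k. dyadic k * indicator (V k) x \<partial>count_space UNIV) \<le> 2 * (maxplus s x * indicator ?I x)"
      by (simp add: epowr_one mult.assoc)
  qed auto
  also have "\<dots> = ennreal (2 powr p) * K * (2 * mass (maxplus s) ?I)"
    by (simp add: nn_integral_cmult mass_def)
  also have "\<dots> = ennreal (2 * 4 powr p) * Ap_plus_const p w * mass (maxplus s) ?I"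
  proof -
    have "(2::ennreal) * (ennreal (2 powr p) * ennreal (2 powr p)) = ennreal (2 * 4 powr p)"
      by (subst ennreal_numeral[symmetric]) (simp add: ennreal_mult[symmetric] powr_mult[symmetric] del: ennreal_numeral)
    moreover have "ennreal (2 powr p) * K * (2 * mass (maxplus s) ?I)
        = 2 * (ennreal (2 powr p) * ennreal (2 powr p)) * Ap_plus_const p w * mass (maxplus s) ?I"
      unfolding K_def by (simp only: ac_simps)
    ultimately show ?thesis by simp
  qed
  finally show ?thesis .
qed

section \<open>Testing estimates for the dual weight\<close>

text \<open>
  A crude form of Young's inequality, tuned to \<open>\<sigma>\<^sup>p\<^sup>-\<^sup>1 w = 1\<close>: if \<open>m\<close> exceeds the first term on the right,
  then \<open>m\<^sup>p\<^sup>-\<^sup>1 w\<close> exceeds \<open>c\<close>, and \<open>m\<close> is at most the second term.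
\<close>

lemma le_dual_weight_plus_weighted_power:
  assumes p: "1 < p" and c: "0 < c" and w: "0 \<le> w x"
  shows "m \<le> ennreal (c powr (1 / (p - 1))) * dual_weight p w x + ennreal (1 / c) * (m epowr p * ennreal (w x))"
proof (cases "w x = 0 \<or> m = top")
  case True
  moreover have "dual_weight p w x = top" if "w x = 0"
    using p that by (simp add: dual_weight_def epowr_def)
  ultimately show ?thesis using p c w
    by (auto simp: ennreal_mult_top ennreal_top_mult epowr_top ennreal_eq_0_iff not_le less_le)
next
  case False
  then have w0: "0 < w x" using w by simp
  obtain r where r: "m = ennreal r" "0 \<le> r" using False by (cases m) auto
  have dw: "dual_weight p w x = ennreal (w x powr (- 1 / (p - 1)))"
    using w0 p by (simp add: dual_weight_def epowr_def)
  have "r \<le> c powr (1 / (p - 1)) * w x powr (- 1 / (p - 1)) + 1 / c * (r powr p * w x)"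
  proof (cases "r \<le> c powr (1 / (p - 1)) * w x powr (- 1 / (p - 1))")
    case True
    then show ?thesis using c w0 by (simp add: add_increasing2)
  next
    case False
    then have "(c powr (1 / (p - 1)) * w x powr (- 1 / (p - 1))) powr (p - 1) \<le> r powr (p - 1)"
      using p by (intro powr_mono2) auto
    then have "c * (1 / w x) \<le> r powr (p - 1)"
      using p c w0 by (simp add: powr_mult powr_divide powr_powr powr_minus_divide)
    then have "r * c \<le> r * (r powr (p - 1) * w x)"
      using w0 r by (intro mult_left_mono) (auto simp: field_simps)
    also have "\<dots> = r powr p * w x"
      using r p by (cases "r = 0") (auto simp: powr_diff)
    finally have "r \<le> 1 / c * (r powr p * w x)" using c by (simp add: field_simps)
    then show ?thesis by (simp add: add_increasing)
  qed
  then show ?thesis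
    using r dw c w0 p by (simp add: epowr_ennreal ennreal_mult[symmetric] ennreal_plus[symmetric] del: ennreal_plus)
qed

text \<open>
  Twice \<open>(2 C)\<^sup>1\<^sup>/\<^sup>(\<^sup>p\<^sup>-\<^sup>1\<^sup>)\<close>, where \<open>C = 2 \<cdot> 4\<^sup>p\<close> is the constant of \<open>weighted_maxplus_le_unweighted\<close>.
\<close>

definition dual_average_constant :: "real \<Rightarrow> real" where
  "dual_average_constant p = 2 * (2 * (2 * 4 powr p)) powr (1 / (p - 1))"

text \<open>
  The estimate improves itself. Let \<open>X\<close> be the left-hand side. By \<open>le_dual_weight_plus_weighted_power\<close> it is
  at most a multiple of \<open>\<sigma>(I)\<close> plus the weighted integral of the \<open>p\<close>-th power divided by \<open>c\<close>, and by
  \<open>weighted_maxplus_le_unweighted\<close> the latter is at most \<open>X / 2\<close> for suitable \<open>c\<close>. Absorbing it requires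
  \<open>X < \<infinity>\<close>, which holds for the truncations \<open>min \<sigma> n\<close>; the general case is their limit.
\<close>

lemma maxplus_dual_weight_le:
  assumes p: "1 < p" and w: "weight w" and A: "0 < Ap_plus_const p w" "Ap_plus_const p w < top"
  shows "mass (maxplus (\<lambda>y. dual_weight p w y * indicator {a<..<b} y)) {a<..<b}
    \<le> ennreal (dual_average_constant p) * Ap_plus_const p w epowr (1 / (p - 1)) * mass (dual_weight p w) {a<..<b}"
proof -
  let ?I = "{a<..<b}" and ?\<sigma> = "dual_weight p w"
  define s where "s n y = min (?\<sigma> y) (of_nat n) * indicator ?I y" for n :: nat and y
  note [measurable] = dual_weight_measurable[OF w] weight_measurable[OF w]
  have I[measurable]: "?I \<in> sets lebesgue" by simp
  have s[measurable]: "s n \<in> borel_measurable lebesgue" for n unfolding s_def by measurable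
  note [measurable] = maxplus_measurable[OF s]
  obtain A where A': "Ap_plus_const p w = ennreal A" "0 < A"
    using A by (cases "Ap_plus_const p w") auto
  \<comment> \<open>Twice the constant of \<open>weighted_maxplus_le_unweighted\<close>, so that the factor \<open>1 / c\<close> leaves one half.\<close>
  define c where "c = 2 * (2 * 4 powr p) * A"
  have c: "0 < c" using A' by (simp add: c_def)
  have step: "mass (maxplus (s n)) ?I \<le> 2 * ennreal (c powr (1 / (p - 1))) * mass ?\<sigma> ?I" (is "?X \<le> _") for n
  proof -
    have "maxplus (s n) x \<le> of_nat n" for x
      unfolding maxplus_le_iff
    proof (intro allI impI)
      fix z assume "x < z"
      have "mass (s n) {x<..<z} \<le> mass (\<lambda>_. of_nat n) {x<..<z}"
        by (intro mass_mono) (auto simp: s_def split: split_indicator)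
      then show "mass (s n) {x<..<z} \<le> of_nat n * ennreal (z - x)" using \<open>x < z\<close> by (simp add: mass_const)
    qed
    then have "?X \<le> mass (\<lambda>_. of_nat n) ?I" by (intro mass_mono) auto
    also have "\<dots> = of_nat n * ennreal (b - a)"
    proof (cases "a \<le> b")
      case False
      then show ?thesis by (simp add: mass_def ennreal_neg)
    qed (rule mass_const)
    also have "\<dots> < top" by (simp add: ennreal_mult_less_top of_nat_less_top)
    finally have fin: "?X < top" .
    have "?X \<le> mass (\<lambda>x. ennreal (c powr (1 / (p - 1))) * ?\<sigma> x
        + ennreal (1 / c) * (maxplus (s n) x epowr p * ennreal (w x))) ?I"
      using p c w by (intro mass_mono le_dual_weight_plus_weighted_power) (auto simp: weight_def)
    also have "\<dots> = ennreal (c powr (1 / (p - 1))) * mass ?\<sigma> ?I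
        + ennreal (1 / c) * mass (\<lambda>x. maxplus (s n) x epowr p * ennreal (w x)) ?I"
      by (simp add: mass_add mass_cmult)
    also have "\<dots> \<le> ennreal (c powr (1 / (p - 1))) * mass ?\<sigma> ?I
        + ennreal (1 / c) * (ennreal (2 * 4 powr p) * Ap_plus_const p w * ?X)"
      by (intro add_left_mono mult_left_mono weighted_maxplus_le_unweighted p w s)
         (auto simp: s_def split: split_indicator)
    also have "ennreal (1 / c) * (ennreal (2 * 4 powr p) * Ap_plus_const p w * ?X) = ennreal (1 / 2) * ?X"
    proof -
      have "ennreal (1 / c) * (ennreal (2 * 4 powr p) * ennreal A) = ennreal (1 / 2)"
      proof -
        have "ennreal (1 / c) * (ennreal (2 * 4 powr p) * ennreal A) = ennreal (1 / c * (2 * 4 powr p * A))"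
          using A' c by (subst ennreal_mult[symmetric], simp, simp, subst ennreal_mult[symmetric], simp_all)
        also have "1 / c * (2 * 4 powr p * A) = 1 / 2" using A' by (simp add: c_def)
        finally show ?thesis .
      qed
      then show ?thesis by (simp add: A' mult.assoc[symmetric])
    qed
    finally have le: "?X \<le> ennreal (c powr (1 / (p - 1))) * mass ?\<sigma> ?I + ennreal (1 / 2) * ?X" .
    show ?thesis
    proof (cases "ennreal (c powr (1 / (p - 1))) * mass ?\<sigma> ?I = top")
      case True
      then show ?thesis by (simp add: mult.assoc ennreal_mult_top)
    next
      case False
      then obtain r where r: "ennreal (c powr (1 / (p - 1))) * mass ?\<sigma> ?I = ennreal r" "0 \<le> r"
        by (cases "ennreal (c powr (1 / (p - 1))) * mass ?\<sigma> ?I") auto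
      obtain q where q: "?X = ennreal q" "0 \<le> q" using fin by (cases ?X) auto
      have "ennreal (r + 1 / 2 * q) = ennreal r + ennreal (1 / 2) * ennreal q"
        using r q by (subst ennreal_plus, simp, simp, subst ennreal_mult, simp_all)
      then have "ennreal q \<le> ennreal (r + 1 / 2 * q)" using le r q by (simp only:)
      then have "q \<le> r + 1 / 2 * q" using r q by (subst (asm) ennreal_le_iff) auto
      then have "ennreal q \<le> ennreal (2 * r)" using r by (intro ennreal_leI) simp
      then show ?thesis using r q by (simp add: mult.assoc ennreal_mult)
    qed
  qed
  have mono: "incseq (\<lambda>n. s n x)" for x
    unfolding s_def by (intro monoI mult_right_mono min.mono of_nat_mono) auto
  have lim: "?\<sigma> y * indicator ?I y = (SUP n. s n y)" for y
  proof -
    have "(SUP n. min (?\<sigma> y) (of_nat n)) = min (?\<sigma> y) (SUP n. of_nat n)"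
      by (simp add: inf_min[symmetric] inf_SUP)
    then show ?thesis by (auto simp: s_def ennreal_SUP_of_nat_eq_top split: split_indicator)
  qed
  have "mass (maxplus (\<lambda>y. ?\<sigma> y * indicator ?I y)) ?I = mass (\<lambda>x. SUP n. maxplus (s n) x) ?I"
    unfolding lim using s mono by (simp add: maxplus_SUP cong: mass_cong)
  also have "\<dots> = (SUP n. mass (maxplus (s n)) ?I)"
    using mono by (intro mass_monotone_convergence) (auto simp: incseq_def intro!: maxplus_mono)
  also have "\<dots> \<le> 2 * ennreal (c powr (1 / (p - 1))) * mass ?\<sigma> ?I"
    by (intro SUP_least step)
  also have "2 * ennreal (c powr (1 / (p - 1))) = ennreal (dual_average_constant p) * Ap_plus_const p w epowr (1 / (p - 1))"
  proof -
    have "c powr (1 / (p - 1)) = (2 * (2 * 4 powr p)) powr (1 / (p - 1)) * A powr (1 / (p - 1))"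
      unfolding c_def using A' by (subst powr_mult) auto
    then show ?thesis
      using A' p by (simp add: dual_average_constant_def epowr_ennreal ennreal_mult mult.assoc)
  qed
  finally show ?thesis .
qed

lemma maxplus_dual_weight_le_Ainf:
  assumes w: "weight w" and fin: "mass (dual_weight p w) {a<..<b} < top" and "a < b"
  shows "mass (maxplus (\<lambda>y. dual_weight p w y * indicator {a<..<b} y)) {a<..<b}
    \<le> Ainf_minus_const (dual_weight p w) * mass (dual_weight p w) {a<..<b}"
proof (cases "mass (dual_weight p w) {a<..<b} = 0")
  case True
  have "maxplus (\<lambda>y. dual_weight p w y * indicator {a<..<b} y) x \<le> 0" for x
    unfolding maxplus_le_iff
  proof (intro allI impI)
    fix z
    have "mass (\<lambda>y. dual_weight p w y * indicator {a<..<b} y) {x<..<z} \<le> mass (dual_weight p w) {a<..<b}"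
      unfolding mass_def by (intro nn_integral_mono) (auto split: split_indicator)
    then show "mass (\<lambda>y. dual_weight p w y * indicator {a<..<b} y) {x<..<z} \<le> 0 * ennreal (z - x)"
      using True by simp
  qed
  then show ?thesis by (simp add: mass_def)
next
  case False
  have "1 / mass (dual_weight p w) {a<..<b} * mass (maxplus (\<lambda>y. dual_weight p w y * indicator {a<..<b} y)) {a<..<b}
      \<le> Ainf_minus_const (dual_weight p w)"
    unfolding Ainf_minus_const_def mass_def[symmetric] mass_closed_interval
    using \<open>a < b\<close> by (intro SUP_upper2[of "(a, b)"]) auto
  then show ?thesis
    using False fin by (subst (asm) ennreal_one_divide_times_le_iff) (auto simp: zero_less_iff_neq_zero)
qed

lemma testing_Ainf:
  assumes p: "1 < p" and w: "weight w" and fin: "mass (dual_weight p w) {a<..<b} < top" and "a < b"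
  shows "mass (\<lambda>x. maxplus (\<lambda>y. dual_weight p w y * indicator {a<..<b} y) x epowr p * ennreal (w x)) {a<..<b}
    \<le> ennreal (2 * 4 powr p) * (Ap_plus_const p w * Ainf_minus_const (dual_weight p w)) * mass (dual_weight p w) {a<..<b}"
proof -
  note [measurable] = dual_weight_measurable[OF w]
  have "mass (\<lambda>x. maxplus (\<lambda>y. dual_weight p w y * indicator {a<..<b} y) x epowr p * ennreal (w x)) {a<..<b}
    \<le> ennreal (2 * 4 powr p) * Ap_plus_const p w * mass (maxplus (\<lambda>y. dual_weight p w y * indicator {a<..<b} y)) {a<..<b}"
    by (intro weighted_maxplus_le_unweighted p w) (auto split: split_indicator)
  also have "\<dots> \<le> ennreal (2 * 4 powr p) * Ap_plus_const p w *
      (Ainf_minus_const (dual_weight p w) * mass (dual_weight p w) {a<..<b})"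
    by (intro mult_left_mono maxplus_dual_weight_le_Ainf w fin \<open>a < b\<close>) auto
  finally show ?thesis by (simp add: ac_simps)
qed

lemma testing_Ap:
  assumes p: "1 < p" and w: "weight w" and A: "Ap_plus_const p w < top"
  shows "mass (\<lambda>x. maxplus (\<lambda>y. dual_weight p w y * indicator {a<..<b} y) x epowr p * ennreal (w x)) {a<..<b}
    \<le> ennreal (2 * 4 powr p * dual_average_constant p) * Ap_plus_const p w epowr (p / (p - 1)) * mass (dual_weight p w) {a<..<b}"
proof -
  note [measurable] = dual_weight_measurable[OF w]
  have *: "mass (\<lambda>x. maxplus (\<lambda>y. dual_weight p w y * indicator {a<..<b} y) x epowr p * ennreal (w x)) {a<..<b}
    \<le> ennreal (2 * 4 powr p) * Ap_plus_const p w * mass (maxplus (\<lambda>y. dual_weight p w y * indicator {a<..<b} y)) {a<..<b}"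
    by (intro weighted_maxplus_le_unweighted p w) (auto split: split_indicator)
  show ?thesis
  proof (cases "Ap_plus_const p w = 0")
    case True
    then show ?thesis using * by simp
  next
    case False
    note *
    also have "ennreal (2 * 4 powr p) * Ap_plus_const p w * mass (maxplus (\<lambda>y. dual_weight p w y * indicator {a<..<b} y)) {a<..<b}
        \<le> ennreal (2 * 4 powr p) * Ap_plus_const p w *
        (ennreal (dual_average_constant p) * Ap_plus_const p w epowr (1 / (p - 1)) * mass (dual_weight p w) {a<..<b})"
      using False A by (intro mult_left_mono maxplus_dual_weight_le p w) (auto simp: zero_less_iff_neq_zero)
    also have "\<dots> = ennreal (2 * 4 powr p) * ennreal (dual_average_constant p) *
        (Ap_plus_const p w * Ap_plus_const p w epowr (1 / (p - 1))) * mass (dual_weight p w) {a<..<b}"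
      by (simp only: ac_simps)
    also have "Ap_plus_const p w * Ap_plus_const p w epowr (1 / (p - 1)) = Ap_plus_const p w epowr (p / (p - 1))"
    proof -
      have "p / (p - 1) = 1 + 1 / (p - 1)" using p by (simp add: field_simps)
      then show ?thesis using p epowr_add[of 1 "1 / (p - 1)"] by (simp add: epowr_one)
    qed
    also have "ennreal (2 * 4 powr p) * ennreal (dual_average_constant p) = ennreal (2 * 4 powr p * dual_average_constant p)"
      by (subst ennreal_mult) (auto simp: dual_average_constant_def)
    finally show ?thesis .
  qed
qed

section \<open>Averages with respect to a measure on the line\<close>

text \<open>
  Take a subfamily with the same union and the fewest members. If a point were in three of its intervals, then
  one of them would be covered by the one that reaches furthest to the left and the one that reaches
  furthest to the right, and could be removed.
\<close>

lemma ex_subcover_overlap_le_2: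
  fixes F :: "real set set"
  assumes "finite F" and intervals: "\<And>J. J \<in> F \<Longrightarrow> \<exists>a b. J = {a<..<b}"
  obtains G where "G \<subseteq> F" "\<Union>G = \<Union>F" "\<And>x. card {J \<in> G. x \<in> J} \<le> 2"
proof -
  define P where "P G \<longleftrightarrow> G \<subseteq> F \<and> \<Union>G = \<Union>F" for G
  have "P F" by (simp add: P_def)
  then obtain G where G: "P G" and least: "\<And>H. P H \<Longrightarrow> card G \<le> card H"
    using ex_has_least_nat[of P F card] by blast
  have finG: "finite G" using G assms(1) finite_subset by (auto simp: P_def)
  have "card {J \<in> G. x \<in> J} \<le> 2" for x
  proof (rule ccontr)
    define N where "N = {J \<in> G. x \<in> J}"
    assume "\<not> card {J \<in> G. x \<in> J} \<le> 2"
    then have N: "2 < card N" "finite N" using finG by (auto simp: N_def)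
    then have "N \<noteq> {}" by auto
    obtain J1 where J1: "J1 \<in> N" "\<And>J. J \<in> N \<Longrightarrow> Inf J1 \<le> Inf J"
      using ex_is_arg_min_if_finite[OF N(2) \<open>N \<noteq> {}\<close>, of Inf] by (auto simp: is_arg_min_linorder)
    obtain J2 where J2: "J2 \<in> N" "\<And>J. J \<in> N \<Longrightarrow> Sup J \<le> Sup J2"
      using ex_is_arg_min_if_finite[OF N(2) \<open>N \<noteq> {}\<close>, of "\<lambda>J. - Sup J"] by (auto simp: is_arg_min_linorder)
    have "card {J1, J2} \<le> 2" by (simp add: card_insert_if)
    then have "\<not> N \<subseteq> {J1, J2}" using N card_mono[of "{J1, J2}" N] by fastforce
    then obtain J3 where J3: "J3 \<in> N" "J3 \<noteq> J1" "J3 \<noteq> J2" by blast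
    have iv: "\<exists>a b. J = {a<..<b} \<and> a < x \<and> x < b \<and> Inf J = a \<and> Sup J = b" if "J \<in> N" for J
    proof -
      have "J \<in> F" using that G by (auto simp: N_def P_def)
      then obtain a b where "J = {a<..<b}" using intervals by blast
      moreover have "x \<in> J" using that by (simp add: N_def)
      ultimately show ?thesis by auto
    qed
    obtain a1 b1 a2 b2 a3 b3 where
      "J1 = {a1<..<b1}" "a1 < x" "x < b1" "Inf J1 = a1" "J2 = {a2<..<b2}" "a2 < x" "x < b2" "Sup J2 = b2"
      "J3 = {a3<..<b3}" "Inf J3 = a3" "Sup J3 = b3"
      using iv[OF J1(1)] iv[OF J2(1)] iv[OF J3(1)] by metis
    moreover have "a1 \<le> a3" "b3 \<le> b2" using J1(2)[OF J3(1)] J2(2)[OF J3(1)] calculation by auto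
    ultimately have "J3 \<subseteq> J1 \<union> J2" by auto
    moreover have "J1 \<in> G - {J3}" "J2 \<in> G - {J3}" using J1 J2 J3 by (auto simp: N_def)
    ultimately have "\<Union>(G - {J3}) = \<Union>G" by blast
    then have "P (G - {J3})" using G by (auto simp: P_def)
    moreover have "card (G - {J3}) < card G"
      using finG J3 by (intro psubset_card_mono) (auto simp: N_def)
    ultimately show False using least by fastforce
  qed
  then show ?thesis using that[of G] G by (auto simp: P_def)
qed

lemma mass_finite_Union_le:
  assumes g: "g \<in> borel_measurable lebesgue" and s: "s \<in> borel_measurable lebesgue"
    and F: "finite F" "\<And>J. J \<in> F \<Longrightarrow> \<exists>a b. J = {a<..<b}"
    and dense: "\<And>J. J \<in> F \<Longrightarrow> t * mass s J \<le> mass g J"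
  shows "t * mass s (\<Union>F) \<le> 2 * mass g (\<Union>F)"
proof -
  obtain G where G: "G \<subseteq> F" "\<Union>G = \<Union>F" "\<And>x. card {J \<in> G. x \<in> J} \<le> 2"
    using ex_subcover_overlap_le_2[OF F] by blast
  have finG: "finite G" using G F finite_subset by blast
  have sets[measurable]: "J \<in> sets lebesgue" if "J \<in> G" for J using F(2) G that by fastforce
  have U: "\<Union>G \<in> sets lebesgue" using finG sets by (intro sets.finite_Union) auto
  have "t * mass s (\<Union>G) \<le> t * (\<Sum>J\<in>G. mass s J)"
  proof (rule mult_left_mono)
    have "emeasure (density lebesgue s) (\<Union>J\<in>G. J) \<le> (\<Sum>J\<in>G. emeasure (density lebesgue s) J)"
      using finG sets by (intro emeasure_subadditive_finite) auto
    then show "mass s (\<Union>G) \<le> (\<Sum>J\<in>G. mass s J)"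
      using U s sets by (simp add: mass_eq_emeasure)
  qed simp
  also have "\<dots> \<le> (\<Sum>J\<in>G. mass g J)"
    unfolding sum_distrib_left using dense G by (intro sum_mono) auto
  also have "\<dots> = (\<integral>\<^sup>+x. (\<Sum>J\<in>G. g x * indicator J x) \<partial>lebesgue)"
    unfolding mass_def using g sets by (intro nn_integral_sum[symmetric]) auto
  also have "\<dots> \<le> (\<integral>\<^sup>+x. 2 * (g x * indicator (\<Union>G) x) \<partial>lebesgue)"
  proof (rule nn_integral_mono)
    fix x
    have "(\<Sum>J\<in>G. g x * indicator J x) = (\<Sum>J\<in>{J \<in> G. x \<in> J}. g x)"
      using finG by (intro sum.mono_neutral_cong_right) auto
    also have "\<dots> = of_nat (card {J \<in> G. x \<in> J}) * g x" by simp
    also have "\<dots> \<le> 2 * (g x * indicator (\<Union>G) x)"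
    proof (cases "x \<in> \<Union>G")
      case True
      have "of_nat (card {J \<in> G. x \<in> J}) \<le> (of_nat 2 :: ennreal)" using G(3)[of x] by (rule of_nat_mono)
      then show ?thesis using True by (simp add: mult_right_mono)
    next
      case False
      then have "{J \<in> G. x \<in> J} = {}" by auto
      then show ?thesis by (simp only: card.empty) simp
    qed
    finally show "(\<Sum>J\<in>G. g x * indicator J x) \<le> 2 * (g x * indicator (\<Union>G) x)" .
  qed
  also have "\<dots> = 2 * mass g (\<Union>G)"
    unfolding mass_def using g U by (intro nn_integral_cmult) auto
  finally show ?thesis by (simp only: G(2))
qed

text \<open>
  The weak type \<open>(1,1)\<close> estimate for the uncentred maximal operator of an arbitrary measure on the line. The
  Lindelof property takes the place of the usual compactness argument.
\<close>

lemma mass_Union_le: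
  assumes g: "g \<in> borel_measurable lebesgue" and s: "s \<in> borel_measurable lebesgue"
    and F: "\<And>J. J \<in> F \<Longrightarrow> \<exists>a b. J = {a<..<b}"
    and dense: "\<And>J. J \<in> F \<Longrightarrow> t * mass s J \<le> mass g J"
  shows "t * mass s (\<Union>F) \<le> 2 * mass g (\<Union>F)"
proof -
  obtain F' where F': "F' \<subseteq> F" "countable F'" "\<Union>F' = \<Union>F"
    using Lindelof[of F] F by (metis open_greaterThanLessThan)
  show ?thesis
  proof (cases "F' = {}")
    case True
    then have "\<Union>F = {}" using F' by simp
    then show ?thesis by (simp only:) (simp add: mass_def)
  next
    case False
    define J where "J = from_nat_into F'"
    have J: "range J = F'" unfolding J_def using False F'(2) by (rule range_from_nat_into)
    define V where "V n = \<Union>(J ` {..n})" for n :: nat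
    have UV: "(\<Union>n. V n) = \<Union>F" unfolding F'(3)[symmetric] J[symmetric] V_def by auto
    have inc: "incseq V" unfolding V_def by (intro monoI) fastforce
    have sets: "V n \<in> sets lebesgue" for n
    proof -
      have "J i \<in> sets lebesgue" for i using F F'(1) J by (metis rangeI sets_lebesgue_interval subsetD)
      then show ?thesis unfolding V_def by auto
    qed
    have "t * mass s (\<Union>n. V n) = (SUP n. t * mass s (V n))"
      using s inc sets by (simp add: mass_SUP_sets SUP_mult_left_ennreal)
    also have "\<dots> \<le> 2 * mass g (\<Union>n. V n)"
    proof (rule SUP_least)
      fix n
      have "t * mass s (V n) \<le> 2 * mass g (V n)"
        unfolding V_def
      proof (rule mass_finite_Union_le[OF g s])
        fix I assume "I \<in> J ` {..n}"
        then have "I \<in> F" using J F'(1) by auto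
        then show "\<exists>a b. I = {a<..<b}" "t * mass s I \<le> mass g I" using F dense by auto
      qed simp
      also have "\<dots> \<le> 2 * mass g (\<Union>n. V n)"
        by (intro mult_left_mono mass_mono) auto
      finally show "t * mass s (V n) \<le> 2 * mass g (\<Union>n. V n)" .
    qed
    finally show ?thesis unfolding UV .
  qed
qed

definition dense_intervals :: "(real \<Rightarrow> ennreal) \<Rightarrow> (real \<Rightarrow> ennreal) \<Rightarrow> real set \<Rightarrow> ennreal \<Rightarrow> real set set" where
  "dense_intervals g s E t = {{a<..<b} |a b. {a<..<b} \<subseteq> E \<and> t * mass s {a<..<b} < mass g {a<..<b}}"

lemma open_Union_dense_intervals: "open (\<Union>(dense_intervals g s E t))"
  by (auto simp: dense_intervals_def)

lemma Union_dense_intervals_subset: "\<Union>(dense_intervals g s E t) \<subseteq> E"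
  by (auto simp: dense_intervals_def)

text \<open>
  The part of \<open>f\<close> below \<open>t / 2\<close> contributes at most half of an average that exceeds \<open>t\<close>. Hence the weak type
  estimate may be applied to the remaining part, as in Marcinkiewicz interpolation.
\<close>

lemma weak_type_dense_intervals:
  fixes t :: ennreal
  assumes f: "f \<in> borel_measurable lebesgue" and s: "s \<in> borel_measurable lebesgue"
    and E: "E \<in> sets lebesgue"
  defines "U \<equiv> \<Union>(dense_intervals (\<lambda>x. f x * s x) s E t)"
  shows "t * mass s U \<le> 4 * mass (\<lambda>x. if t < 2 * f x then f x * s x else 0) E"
proof -
  let ?g = "\<lambda>x. if t < 2 * f x then f x * s x else 0"
  have g: "?g \<in> borel_measurable lebesgue" using f s by measurable
  have "t * mass s U \<le> 2 * mass (\<lambda>x. 2 * ?g x) U"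
    unfolding U_def
  proof (rule mass_Union_le)
    show "(\<lambda>x. 2 * ?g x) \<in> borel_measurable lebesgue" using g by measurable
    fix J assume J: "J \<in> dense_intervals (\<lambda>x. f x * s x) s E t"
    then show iv: "\<exists>a b. J = {a<..<b}" by (auto simp: dense_intervals_def)
    then have sJ: "J \<in> sets lebesgue" by auto
    show "t * mass s J \<le> mass (\<lambda>x. 2 * ?g x) J"
    proof (rule ccontr)
      assume "\<not> t * mass s J \<le> mass (\<lambda>x. 2 * ?g x) J"
      then have less: "mass (\<lambda>x. 2 * ?g x) J \<le> t * mass s J" by simp
      have "2 * mass (\<lambda>x. f x * s x) J = mass (\<lambda>x. 2 * (f x * s x)) J"
        using f s sJ by (simp add: mass_cmult)
      also have "\<dots> \<le> mass (\<lambda>x. 2 * ?g x + t * s x) J"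
      proof (rule mass_mono)
        fix x
        show "2 * (f x * s x) \<le> 2 * ?g x + t * s x"
        proof (cases "t < 2 * f x")
          case False
          then have "2 * f x * s x \<le> t * s x" by (intro mult_right_mono) auto
          then show ?thesis using False by (simp add: mult.assoc)
        qed auto
      qed simp
      also have "\<dots> = mass (\<lambda>x. 2 * ?g x) J + t * mass s J"
        using g s sJ by (subst mass_add) (auto simp: mass_cmult)
      also have "\<dots> \<le> t * mass s J + t * mass s J" using less by (intro add_right_mono)
      also have "\<dots> = 2 * (t * mass s J)" by (simp add: mult_2)
      finally have "mass (\<lambda>x. f x * s x) J \<le> t * mass s J"
        by (subst (asm) ennreal_mult_le_mult_iff) auto
      then show False using J by (auto simp: dense_intervals_def)
    qed
  qed (fact s)
  also have "\<dots> \<le> 2 * mass (\<lambda>x. 2 * ?g x) E"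
    unfolding U_def by (intro mult_left_mono mass_mono Union_dense_intervals_subset) auto
  also have "\<dots> = 2 * (2 * mass ?g E)" using mass_cmult[OF g E, of 2] by simp
  also have "\<dots> = 4 * mass ?g E" by (simp add: mult.assoc[symmetric])
  finally show ?thesis .
qed

text \<open>
  The weak type constant \<open>4\<close>, the factor \<open>2\<^sup>p\<close> between consecutive levels, and the geometric series of
  \<open>dyadic_geometric_sum\<close> with exponent \<open>p - 1\<close> summed up to \<open>2 f(x)\<close>.
\<close>

definition strong_type_constant :: "real \<Rightarrow> real" where
  "strong_type_constant p = 4 * 2 powr p * (2 powr (p - 1) / (1 - 2 powr (- (p - 1))))"

text \<open>
  The sum of the weak type estimates; at a point \<open>x\<close> only the levels below \<open>2 f(x)\<close> contribute, so the
  geometric series produces \<open>f\<^sup>p\<^sup>-\<^sup>1\<close>.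
\<close>

lemma strong_type_dyadic_sum:
  assumes p: "1 < p" and f: "f \<in> borel_measurable lebesgue" and s: "s \<in> borel_measurable lebesgue"
    and E: "E \<in> sets lebesgue"
  defines "U \<equiv> \<lambda>k. \<Union>(dense_intervals (\<lambda>x. f x * s x) s E (dyadic k))"
  shows "(\<integral>\<^sup>+k. dyadic (k + 1) epowr p * mass s (U k) \<partial>count_space UNIV)
    \<le> ennreal (strong_type_constant p) * mass (\<lambda>x. f x epowr p * s x) E"
proof -
  have [measurable]: "E \<in> sets lebesgue" "f \<in> borel_measurable lebesgue" "s \<in> borel_measurable lebesgue"
    using f s E by auto
  define g where "g k x = (if dyadic k < 2 * f x then f x * s x else 0)" for k x
  have [measurable]: "g k \<in> borel_measurable lebesgue" for k unfolding g_def by measurable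
  have z: "2 powr (- (p - 1)) < 1" using p by (intro powr_less_one) auto
  have "dyadic (k + 1) epowr p * mass s (U k) \<le> ennreal (4 * 2 powr p) * (dyadic k epowr (p - 1) * mass (g k) E)" for k
  proof -
    have "dyadic (k + 1) epowr p = ennreal (2 powr p) * (dyadic k epowr (p - 1) * dyadic k)"
      using p epowr_add[of "p - 1" 1 "dyadic k"] epowr_ennreal[of p 2]
      by (simp add: dyadic_Suc epowr_mult epowr_one)
    then have "dyadic (k + 1) epowr p * mass s (U k)
        = ennreal (2 powr p) * dyadic k epowr (p - 1) * (dyadic k * mass s (U k))"
      by (simp add: ac_simps)
    also have "\<dots> \<le> ennreal (2 powr p) * dyadic k epowr (p - 1) * (4 * mass (g k) E)"
      unfolding U_def g_def by (intro mult_left_mono weak_type_dense_intervals f s E) auto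
    also have "\<dots> = 4 * ennreal (2 powr p) * (dyadic k epowr (p - 1) * mass (g k) E)"
      by (simp add: ac_simps)
    also have "4 * ennreal (2 powr p) = ennreal (4 * 2 powr p)"
      by (subst ennreal_mult) auto
    finally show ?thesis .
  qed
  then have "(\<integral>\<^sup>+k. dyadic (k + 1) epowr p * mass s (U k) \<partial>count_space UNIV)
      \<le> (\<integral>\<^sup>+k. ennreal (4 * 2 powr p) * (dyadic k epowr (p - 1) * mass (g k) E) \<partial>count_space UNIV)"
    by (intro nn_integral_mono) auto
  also have "\<dots> = ennreal (4 * 2 powr p) * (\<integral>\<^sup>+k. (\<integral>\<^sup>+x. dyadic k epowr (p - 1) * (g k x * indicator E x) \<partial>lebesgue) \<partial>count_space UNIV)"
    by (simp add: nn_integral_cmult mass_def)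
  also have "\<dots> = ennreal (4 * 2 powr p) * (\<integral>\<^sup>+x. (\<integral>\<^sup>+k. dyadic k epowr (p - 1) * (g k x * indicator E x) \<partial>count_space UNIV) \<partial>lebesgue)"
    by (subst nn_integral_count_space_nn_integral) auto
  also have "\<dots> \<le> ennreal (4 * 2 powr p) * (\<integral>\<^sup>+x. ennreal (2 powr (p - 1) / (1 - 2 powr (- (p - 1)))) * (f x epowr p * s x * indicator E x) \<partial>lebesgue)"
  proof (intro mult_left_mono nn_integral_mono)
    fix x
    have "(\<integral>\<^sup>+k. dyadic k epowr (p - 1) * (g k x * indicator E x) \<partial>count_space UNIV)
        \<le> (\<integral>\<^sup>+k. (if dyadic k \<le> 2 * f x then dyadic k epowr (p - 1) else 0) * (f x * s x * indicator E x) \<partial>count_space UNIV)"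
      by (intro nn_integral_mono) (auto simp: g_def)
    also have "\<dots> = (\<integral>\<^sup>+k. (if dyadic k \<le> 2 * f x then dyadic k epowr (p - 1) else 0) \<partial>count_space UNIV) * (f x * s x * indicator E x)"
      by (rule nn_integral_multc) simp
    also have "\<dots> \<le> ennreal (1 / (1 - 2 powr (- (p - 1)))) * (2 * f x) epowr (p - 1) * (f x * s x * indicator E x)"
      using p by (intro mult_right_mono dyadic_geometric_sum) auto
    also have "(2 * f x) epowr (p - 1) = ennreal (2 powr (p - 1)) * f x epowr (p - 1)"
      using p epowr_ennreal[of "p - 1" 2] by (simp add: epowr_mult)
    also have "ennreal (1 / (1 - 2 powr (- (p - 1)))) * (ennreal (2 powr (p - 1)) * f x epowr (p - 1)) * (f x * s x * indicator E x)
        = (ennreal (1 / (1 - 2 powr (- (p - 1)))) * ennreal (2 powr (p - 1))) * ((f x epowr (p - 1) * f x) * s x * indicator E x)"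
      by (simp only: ac_simps)
    also have "f x epowr (p - 1) * f x = f x epowr p"
      using p epowr_add[of "p - 1" 1 "f x"] by (simp add: epowr_one)
    also have "ennreal (1 / (1 - 2 powr (- (p - 1)))) * ennreal (2 powr (p - 1)) = ennreal (2 powr (p - 1) / (1 - 2 powr (- (p - 1))))"
      using z by (subst ennreal_mult[symmetric]) auto
    finally show "(\<integral>\<^sup>+k. dyadic k epowr (p - 1) * (g k x * indicator E x) \<partial>count_space UNIV)
        \<le> ennreal (2 powr (p - 1) / (1 - 2 powr (- (p - 1)))) * (f x epowr p * s x * indicator E x)" .
  qed auto
  also have "\<dots> = ennreal (4 * 2 powr p) * (ennreal (2 powr (p - 1) / (1 - 2 powr (- (p - 1)))) * mass (\<lambda>x. f x epowr p * s x) E)"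
    by (subst nn_integral_cmult) (auto simp: mass_def)
  also have "\<dots> = ennreal (strong_type_constant p) * mass (\<lambda>x. f x epowr p * s x) E"
    unfolding mult.assoc[symmetric] strong_type_constant_def
    using z by (subst ennreal_mult[symmetric]) auto
  finally show ?thesis .
qed

section \<open>From testing to the strong type\<close>

text \<open>
  The core of the argument that testing suffices. Components of the open sets \<open>U k\<close> take the place of the
  principal intervals of a stopping-time construction.
\<close>

lemma strong_type_on_window_if_testing:
  assumes p: "1 < p" and w: "weight w" and f: "f \<in> borel_measurable lebesgue"
    and s: "s \<in> borel_measurable lebesgue"
    and fin: "mass s {A<..<B} < top" "mass (\<lambda>x. f x * s x) {A<..<B} < top"
    and testing: "\<And>a b. A \<le> a \<Longrightarrow> a < b \<Longrightarrow> b \<le> B \<Longrightarrow>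
      mass (\<lambda>x. maxplus (\<lambda>y. s y * indicator {a<..<b} y) x epowr p * ennreal (w x)) {a<..<b}
        \<le> K * mass s {a<..<b}"
  shows "mass (\<lambda>x. maxplus (\<lambda>y. f y * s y * indicator {A<..<B} y) x epowr p * ennreal (w x)) {A<..<B}
    \<le> ennreal (strong_type_constant p) * K * mass (\<lambda>x. f x epowr p * s x) {A<..<B}"
proof -
  let ?W = "\<lambda>x. ennreal (w x)" and ?g = "\<lambda>x. f x * s x" and ?E = "{A<..<B}"
  define U where "U k = \<Union>(dense_intervals ?g s ?E (dyadic k))" for k
  define m where "m J = maxplus (\<lambda>y. s y * indicator J y)" for J
  have oU: "open (U k)" for k unfolding U_def by (rule open_Union_dense_intervals)
  have subU: "U k \<subseteq> ?E" for k unfolding U_def by (rule Union_dense_intervals_subset)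
  have bU: "bounded (U k)" for k by (rule bounded_subset[OF _ subU]) simp
  have oJ: "open J" if "J \<in> components (U k)" for J k using open_components[OF oU that] .
  note [measurable] = weight_measurable[OF w] f s
  have mm: "m J \<in> borel_measurable lebesgue" if "J \<in> components (U k)" for J k
  proof -
    have [measurable]: "J \<in> sets lebesgue" using oJ[OF that] by (rule sets_lebesgue_open)
    show ?thesis unfolding m_def by (intro maxplus_measurable) measurable
  qed
  have tm: "(\<lambda>x. m J x epowr p * ?W x * indicator J x) \<in> borel_measurable lebesgue" if "J \<in> components (U k)" for J k
  proof -
    have [measurable]: "J \<in> sets lebesgue" using oJ[OF that] by (rule sets_lebesgue_open)
    show ?thesis using mm[OF that] by measurable
  qed
  \<comment> \<open>The \<open>p\<close>-th power of the supremum over levels and components, relaxed to a sum.\<close>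
  define R where "R x = (\<integral>\<^sup>+k. (\<integral>\<^sup>+J. dyadic (k + 1) epowr p * (m J x epowr p * indicator J x) \<partial>count_space (components (U k))) \<partial>count_space UNIV)" for x
  have point: "maxplus (\<lambda>y. ?g y * indicator ?E y) x \<le> R x epowr (1 / p)" if x: "x \<in> ?E" for x
    unfolding maxplus_le_iff
  proof (intro allI impI)
    fix z0 assume "x < z0"
    \<comment> \<open>To the right of \<open>B\<close> the function vanishes, so cutting the interval at \<open>B\<close> only increases the average.\<close>
    define z where "z = min z0 B"
    have z: "x < z" "z \<le> B" "z \<le> z0" using x \<open>x < z0\<close> by (auto simp: z_def)
    have eq: "mass (\<lambda>y. ?g y * indicator ?E y) {x<..<z0} = mass ?g {x<..<z}"
      unfolding mass_def using x by (intro nn_integral_cong) (auto simp: z_def split: split_indicator)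
    have "mass ?g {x<..<z} \<le> R x epowr (1 / p) * ennreal (z - x)"
    proof (cases "mass ?g {x<..<z} = 0")
      case False
      have finz: "mass s {x<..<z} < top" "mass ?g {x<..<z} < top"
        using x z by (auto intro: le_less_trans[OF mass_mono fin(1)] le_less_trans[OF mass_mono fin(2)])
      have s0: "mass s {x<..<z} \<noteq> 0"
      proof
        assume "mass s {x<..<z} = 0"
        then have "AE y in lebesgue. s y * indicator {x<..<z} y = 0"
          unfolding mass_def by (subst (asm) nn_integral_0_iff_AE) auto
        then have "AE y in lebesgue. ?g y * indicator {x<..<z} y = 0" by eventually_elim auto
        then have "mass ?g {x<..<z} = 0" unfolding mass_def by (subst nn_integral_0_iff_AE) auto
        then show False using False by simp
      qed
      define F where "F = mass ?g {x<..<z} / mass s {x<..<z}"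
      have F: "mass ?g {x<..<z} = F * mass s {x<..<z}" "0 < F" "F < top"
        using s0 finz False unfolding F_def
        by (auto simp: ennreal_divide_times ennreal_times_divide ennreal_mult_divide_eq ennreal_zero_less_divide
            less_top[symmetric] ennreal_divide_eq_top_iff zero_less_iff_neq_zero)
      then obtain k where k: "dyadic k < F" "F \<le> dyadic (k + 1)" using ex_dyadic_between by blast
      have "dyadic k * mass s {x<..<z} < mass ?g {x<..<z}"
        unfolding F(1) using k s0 finz by (intro ennreal_mult_strict_right_mono) (auto simp: zero_less_iff_neq_zero)
      then have "mass (\<lambda>y. dyadic k * s y) {x<..<z} < mass ?g {x<..<z}" by (simp add: mass_cmult)
      \<comment> \<open>The interval has to be enlarged to the left, as \<open>x\<close> itself must lie in the open set \<open>U k\<close>.\<close>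
      moreover have "mass (\<lambda>y. dyadic k * s y) {A<..<z} < \<infinity>"
      proof -
        have "mass s {A<..<z} \<le> mass s ?E" using z by (intro mass_mono) auto
        then have "mass s {A<..<z} < top" using fin(1) by (rule le_less_trans)
        then show ?thesis using dyadic_less_top[of k] by (simp add: mass_cmult ennreal_mult_less_top)
      qed
      ultimately obtain y where y: "A < y" "y < x" "mass (\<lambda>y. dyadic k * s y) {y<..<z} < mass ?g {x<..<z}"
        using mass_less_enlarge_left[of "\<lambda>y. dyadic k * s y" A z x] x by auto
      have "mass ?g {x<..<z} \<le> mass ?g {y<..<z}" using y by (intro mass_mono) auto
      then have "dyadic k * mass s {y<..<z} < mass ?g {y<..<z}" using y by (simp add: mass_cmult)
      then have "{y<..<z} \<in> dense_intervals ?g s ?E (dyadic k)"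
        unfolding dense_intervals_def using y z by (intro CollectI exI conjI refl) auto
      then have sub: "{y<..<z} \<subseteq> U k" by (auto simp: U_def)
      have xin: "x \<in> {y<..<z}" using y z by auto
      define J where "J = connected_component_set (U k) x"
      have J: "J \<in> components (U k)" using sub xin by (auto simp: J_def components_def)
      have "{y<..<z} \<subseteq> J" unfolding J_def
        using sub xin by (intro connected_component_maximal) auto
      then have "mass s {x<..<z} = mass (\<lambda>y. s y * indicator J y) {x<..<z}"
        using y by (intro mass_cong) (auto simp: subset_iff split: split_indicator)
      also have "\<dots> \<le> m J x * ennreal (z - x)" unfolding m_def using z by (intro mass_le_maxplus)
      finally have "F * mass s {x<..<z} \<le> dyadic (k + 1) * (m J x * ennreal (z - x))"
        using k by (intro mult_mono) auto
      moreover have "dyadic (k + 1) * m J x \<le> R x epowr (1 / p)"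
      proof -
        have "x \<in> J" using \<open>{y<..<z} \<subseteq> J\<close> xin by blast
        have "(dyadic (k + 1) * m J x) epowr p = dyadic (k + 1) epowr p * (m J x epowr p * indicator J x)"
          using p \<open>x \<in> J\<close> by (simp add: epowr_mult)
        also have "\<dots> \<le> (\<integral>\<^sup>+J. dyadic (k + 1) epowr p * (m J x epowr p * indicator J x) \<partial>count_space (components (U k)))"
          by (rule nn_integral_ge_point) (fact J)
        also have "\<dots> \<le> R x" unfolding R_def by (rule nn_integral_ge_point) simp
        finally show ?thesis using p epowr_le_iff by simp
      qed
      ultimately show ?thesis
        unfolding F(1)
        using mult_right_mono[of "dyadic (k + 1) * m J x" "R x epowr (1 / p)" "ennreal (z - x)"]
        by (simp add: mult.assoc)
    qed simp
    also have "\<dots> \<le> R x epowr (1 / p) * ennreal (z0 - x)"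
      using z by (intro mult_left_mono ennreal_leI) auto
    finally show "mass (\<lambda>y. ?g y * indicator ?E y) {x<..<z0} \<le> R x epowr (1 / p) * ennreal (z0 - x)"
      unfolding eq .
  qed
  have "mass (\<lambda>x. maxplus (\<lambda>y. ?g y * indicator ?E y) x epowr p * ?W x) ?E \<le> mass (\<lambda>x. R x * ?W x) ?E"
    using point p by (intro mass_mono mult_right_mono) (auto simp: epowr_le_iff)
  also have "\<dots> \<le> (\<integral>\<^sup>+x. (\<integral>\<^sup>+k. (\<integral>\<^sup>+J. dyadic (k + 1) epowr p * (m J x epowr p * ?W x * indicator J x) \<partial>count_space (components (U k))) \<partial>count_space UNIV) \<partial>lebesgue)"
    unfolding mass_def
  proof (intro nn_integral_mono)
    fix x
    have "R x * ?W x = (\<integral>\<^sup>+k. (\<integral>\<^sup>+J. dyadic (k + 1) epowr p * (m J x epowr p * ?W x * indicator J x) \<partial>count_space (components (U k))) \<partial>count_space UNIV)"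
      unfolding R_def
      by (simp add: nn_integral_cmult[symmetric] ac_simps)
    then show "R x * ?W x * indicator ?E x \<le> (\<integral>\<^sup>+k. (\<integral>\<^sup>+J. dyadic (k + 1) epowr p * (m J x epowr p * ?W x * indicator J x) \<partial>count_space (components (U k))) \<partial>count_space UNIV)"
      by (auto split: split_indicator)
  qed
  also have "\<dots> = (\<integral>\<^sup>+k. (\<integral>\<^sup>+x. (\<integral>\<^sup>+J. dyadic (k + 1) epowr p * (m J x epowr p * ?W x * indicator J x) \<partial>count_space (components (U k))) \<partial>lebesgue) \<partial>count_space UNIV)"
  proof (rule nn_integral_count_space_nn_integral)
    fix k
    show "(\<lambda>x. \<integral>\<^sup>+J. dyadic (k + 1) epowr p * (m J x epowr p * ?W x * indicator J x) \<partial>count_space (components (U k))) \<in> borel_measurable lebesgue"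
      using tm countable_components_open[OF oU]
      by (intro borel_measurable_nn_integral_count_space) auto
  qed simp
  also have "\<dots> = (\<integral>\<^sup>+k. (\<integral>\<^sup>+J. dyadic (k + 1) epowr p * mass (\<lambda>x. m J x epowr p * ?W x) J \<partial>count_space (components (U k))) \<partial>count_space UNIV)"
  proof (rule nn_integral_cong)
    fix k
    have "(\<integral>\<^sup>+x. (\<integral>\<^sup>+J. dyadic (k + 1) epowr p * (m J x epowr p * ?W x * indicator J x) \<partial>count_space (components (U k))) \<partial>lebesgue)
        = (\<integral>\<^sup>+J. (\<integral>\<^sup>+x. dyadic (k + 1) epowr p * (m J x epowr p * ?W x * indicator J x) \<partial>lebesgue) \<partial>count_space (components (U k)))"
      using tm countable_components_open[OF oU]
      by (intro nn_integral_count_space_nn_integral) auto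
    also have "\<dots> = (\<integral>\<^sup>+J. dyadic (k + 1) epowr p * mass (\<lambda>x. m J x epowr p * ?W x) J \<partial>count_space (components (U k)))"
      using tm by (intro nn_integral_cong) (auto simp: mass_def nn_integral_cmult)
    finally show "(\<integral>\<^sup>+x. (\<integral>\<^sup>+J. dyadic (k + 1) epowr p * (m J x epowr p * ?W x * indicator J x) \<partial>count_space (components (U k))) \<partial>lebesgue)
        = (\<integral>\<^sup>+J. dyadic (k + 1) epowr p * mass (\<lambda>x. m J x epowr p * ?W x) J \<partial>count_space (components (U k)))" .
  qed
  also have "\<dots> \<le> (\<integral>\<^sup>+k. (\<integral>\<^sup>+J. dyadic (k + 1) epowr p * (K * mass s J) \<partial>count_space (components (U k))) \<partial>count_space UNIV)"
  proof (intro nn_integral_mono mult_left_mono)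
    fix k J assume "J \<in> space (count_space (components (U k)))"
    then have J: "J \<in> components (U k)" by simp
    obtain a b where ab: "a < b" "J = {a<..<b}" using bounded_component_interval[OF oU bU J] by metis
    then have "{a<..<b} \<subseteq> {A<..<B}" using J subU[of k] in_components_subset by blast
    then have "A \<le> a" "b \<le> B" using ab by (auto simp: greaterThanLessThan_subseteq_greaterThanLessThan)
    then show "mass (\<lambda>x. m J x epowr p * ?W x) J \<le> K * mass s J"
      unfolding m_def ab(2) by (intro testing ab)
  qed simp
  also have "\<dots> = (\<integral>\<^sup>+k. K * (dyadic (k + 1) epowr p * mass s (U k)) \<partial>count_space UNIV)"
  proof (rule nn_integral_cong)
    fix k
    have "(\<integral>\<^sup>+J. dyadic (k + 1) epowr p * (K * mass s J) \<partial>count_space (components (U k)))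
      = dyadic (k + 1) epowr p * (K * (\<integral>\<^sup>+J. mass s J \<partial>count_space (components (U k))))"
      by (simp add: nn_integral_cmult)
    then show "(\<integral>\<^sup>+J. dyadic (k + 1) epowr p * (K * mass s J) \<partial>count_space (components (U k)))
      = K * (dyadic (k + 1) epowr p * mass s (U k))"
      using mass_components[OF s oU] by (simp add: ac_simps)
  qed
  also have "\<dots> = K * (\<integral>\<^sup>+k. dyadic (k + 1) epowr p * mass s (U k) \<partial>count_space UNIV)"
    by (simp add: nn_integral_cmult)
  also have "\<dots> \<le> K * (ennreal (strong_type_constant p) * mass (\<lambda>x. f x epowr p * s x) ?E)"
    unfolding U_def by (intro mult_left_mono strong_type_dyadic_sum p f s) auto
  finally show ?thesis by (simp add: ac_simps)
qed

text \<open>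
  The passage from \<open>f\<close> to \<open>\<phi> = \<bar>f\<bar> / \<sigma>\<close>. Where \<open>w\<close> vanishes the factorisation \<open>\<bar>f\<bar> = \<phi>\<sigma>\<close> fails, but
  integrability of \<open>\<sigma>\<close> on the window makes this a null set. The local integrability of \<open>f\<close> comes from
  \<open>\<phi>\<sigma> \<le> \<sigma> + \<phi>\<^sup>p\<sigma>\<close>.
\<close>

lemma strong_type_on_window:
  assumes p: "1 < p" and w: "weight w" and f: "f \<in> borel_measurable lebesgue"
    and fin: "mass (dual_weight p w) {A<..<B} < top"
    and finf: "mass (\<lambda>x. ennreal \<bar>f x\<bar> epowr p * ennreal (w x)) UNIV < top"
    and testing: "\<And>a b. a < b \<Longrightarrow> mass (dual_weight p w) {a<..<b} < top \<Longrightarrow>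
      mass (\<lambda>x. maxplus (\<lambda>y. dual_weight p w y * indicator {a<..<b} y) x epowr p * ennreal (w x)) {a<..<b}
        \<le> K * mass (dual_weight p w) {a<..<b}"
  shows "mass (\<lambda>x. maxplus (\<lambda>y. ennreal \<bar>f y\<bar> * indicator {A<..<B} y) x epowr p * ennreal (w x)) {A<..<B}
    \<le> ennreal (strong_type_constant p) * K * mass (\<lambda>x. ennreal \<bar>f x\<bar> epowr p * ennreal (w x)) UNIV"
proof -
  let ?E = "{A<..<B}" and ?\<sigma> = "dual_weight p w"
  define \<phi> where "\<phi> x = ennreal (\<bar>f x\<bar> * w x powr (1 / (p - 1)))" for x
  have w0: "0 \<le> w x" for x using w by (simp add: weight_def)
  have [measurable]: "w \<in> borel_measurable lebesgue" using w by (simp add: weight_def)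
  note [measurable] = f dual_weight_measurable[OF w]
  have \<phi>[measurable]: "\<phi> \<in> borel_measurable lebesgue" unfolding \<phi>_def by measurable
  have dw: "?\<sigma> x = ennreal (w x powr (- 1 / (p - 1)))" if "w x \<noteq> 0" for x
    using that w0[of x] p by (simp add: dual_weight_def epowr_def)
  have \<phi>\<sigma>: "\<phi> x * ?\<sigma> x = ennreal \<bar>f x\<bar>" if "w x \<noteq> 0" for x
  proof -
    have "w x powr (1 / (p - 1)) * w x powr (- 1 / (p - 1)) = 1"
      using that w0[of x] by (simp add: powr_add[symmetric])
    then have "\<bar>f x\<bar> * w x powr (1 / (p - 1)) * w x powr (- 1 / (p - 1)) = \<bar>f x\<bar>"
      by (simp add: mult.assoc)
    then show ?thesis using that by (simp add: dw \<phi>_def ennreal_mult[symmetric])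
  qed
  have \<phi>p: "\<phi> x epowr p * ?\<sigma> x = ennreal \<bar>f x\<bar> epowr p * ennreal (w x)" for x
  proof (cases "w x = 0")
    case False
    have e: "1 / (p - 1) * p + - 1 / (p - 1) = 1" using p by (simp add: diff_divide_distrib[symmetric])
    have "(\<bar>f x\<bar> * w x powr (1 / (p - 1))) powr p * w x powr (- 1 / (p - 1))
        = \<bar>f x\<bar> powr p * (w x powr (1 / (p - 1) * p) * w x powr (- 1 / (p - 1)))"
      by (simp add: powr_mult powr_powr)
    also have "w x powr (1 / (p - 1) * p) * w x powr (- 1 / (p - 1)) = w x"
      using False w0[of x] by (simp only: powr_add[symmetric] e) simp
    finally show ?thesis
      using p False w0[of x] by (simp add: \<phi>_def dw epowr_ennreal ennreal_mult[symmetric])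
  qed (use p in \<open>simp add: \<phi>_def epowr_zero\<close>)
  have "AE x in lebesgue. ?\<sigma> x * indicator ?E x \<noteq> \<infinity>"
    using fin by (intro nn_integral_PInf_AE) (auto simp: mass_def)
  then have "AE x in lebesgue. ennreal \<bar>f x\<bar> * indicator ?E x = \<phi> x * ?\<sigma> x * indicator ?E x"
  proof eventually_elim
    case (elim x)
    have "?\<sigma> x = \<infinity>" if "w x = 0" using that p by (simp add: dual_weight_def epowr_def)
    then show ?case using elim \<phi>\<sigma>[of x] by (cases "w x = 0") (auto split: split_indicator)
  qed
  from maxplus_cong_AE[OF this]
  have eq: "maxplus (\<lambda>y. ennreal \<bar>f y\<bar> * indicator ?E y) x = maxplus (\<lambda>y. \<phi> y * ?\<sigma> y * indicator ?E y) x" for x .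
  have "mass (\<lambda>x. \<phi> x * ?\<sigma> x) ?E \<le> mass (\<lambda>x. ?\<sigma> x + \<phi> x epowr p * ?\<sigma> x) ?E"
  proof (rule mass_mono)
    fix x
    have "\<phi> x * ?\<sigma> x \<le> (1 + \<phi> x epowr p) * ?\<sigma> x"
      using p by (intro mult_right_mono le_one_plus_epowr) auto
    then show "\<phi> x * ?\<sigma> x \<le> ?\<sigma> x + \<phi> x epowr p * ?\<sigma> x" by (simp add: distrib_right)
  qed simp
  also have "\<dots> = mass ?\<sigma> ?E + mass (\<lambda>x. \<phi> x epowr p * ?\<sigma> x) ?E"
    by (intro mass_add) auto
  also have "\<dots> \<le> mass ?\<sigma> ?E + mass (\<lambda>x. ennreal \<bar>f x\<bar> epowr p * ennreal (w x)) UNIV"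
    by (intro add_left_mono mass_mono) (auto simp: \<phi>p)
  also have "\<dots> < top" using fin finf by simp
  finally have fin2: "mass (\<lambda>x. \<phi> x * ?\<sigma> x) ?E < top" .
  have "mass (\<lambda>x. maxplus (\<lambda>y. \<phi> y * ?\<sigma> y * indicator ?E y) x epowr p * ennreal (w x)) ?E
      \<le> ennreal (strong_type_constant p) * K * mass (\<lambda>x. \<phi> x epowr p * ?\<sigma> x) ?E"
  proof (rule strong_type_on_window_if_testing[OF p w \<phi> _ fin fin2])
    fix a b :: real assume ab: "A \<le> a" "a < b" "b \<le> B"
    then have "mass ?\<sigma> {a<..<b} \<le> mass ?\<sigma> ?E" by (intro mass_mono) auto
    then show "mass (\<lambda>x. maxplus (\<lambda>y. ?\<sigma> y * indicator {a<..<b} y) x epowr p * ennreal (w x)) {a<..<b}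
        \<le> K * mass ?\<sigma> {a<..<b}"
      using testing ab fin by (auto intro: le_less_trans)
  qed measurable
  also have "\<dots> \<le> ennreal (strong_type_constant p) * K * mass (\<lambda>x. ennreal \<bar>f x\<bar> epowr p * ennreal (w x)) UNIV"
    by (intro mult_left_mono mass_mono) (auto simp: \<phi>p)
  finally show ?thesis unfolding eq .
qed

text \<open>
  Two monotone limits: the cut-off of \<open>h\<close> is removed on a fixed window, and then the window is enlarged.
\<close>

lemma strong_type_on_half_line:
  assumes p: "1 < p" and w: "weight w" and h: "h \<in> borel_measurable lebesgue"
    and windows: "\<And>n::nat. mass (\<lambda>x. maxplus (\<lambda>y. h y * indicator {q<..<q + n} y) x epowr p * ennreal (w x)) {q<..<q + n} \<le> D"
  shows "mass (\<lambda>x. maxplus h x epowr p * ennreal (w x)) {q<..} \<le> D"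
proof -
  define E where "E n = {q<..<q + real n}" for n
  define u where "u n y = h y * indicator (E n) y" for n y
  note [measurable] = weight_measurable[OF w] h
  have [measurable]: "E n \<in> sets lebesgue" for n unfolding E_def by measurable
  have u[measurable]: "u n \<in> borel_measurable lebesgue" for n unfolding u_def by measurable
  note [measurable] = maxplus_measurable[OF u]
  have Emono: "E m \<subseteq> E n" if "m \<le> n" for m n using that by (auto simp: E_def)
  have umono: "u m y \<le> u n y" if "m \<le> n" for m n y
    using Emono[OF that] by (auto simp: u_def split: split_indicator)
  have UE: "(\<Union>n. E n) = {q<..}"
  proof (intro set_eqI iffI)
    fix x assume "x \<in> {q<..}"
    moreover obtain n where "x - q < real n" using reals_Archimedean2 by blast
    ultimately show "x \<in> (\<Union>n. E n)" by (auto simp: E_def intro!: exI[of _ n])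
  qed (auto simp: E_def)
  have lim: "maxplus h x = (SUP n. maxplus (u n) x)" if "q < x" for x
  proof -
    have "maxplus h x = maxplus (\<lambda>y. SUP n. u n y) x"
    proof -
      have "(SUP n. u n y) = h y" if "q < y" for y
      proof (rule antisym)
        show "(SUP n. u n y) \<le> h y" by (intro SUP_least) (auto simp: u_def split: split_indicator)
        obtain n where "y \<in> E n" using UE \<open>q < y\<close> by blast
        then have "h y = u n y" by (simp add: u_def)
        then show "h y \<le> (SUP n. u n y)" by (metis SUP_upper UNIV_I)
      qed
      then have "mass (\<lambda>y. SUP n. u n y) {x<..<z} = mass h {x<..<z}" for z
        using \<open>q < x\<close> by (intro mass_cong) auto
      then show ?thesis by (rule maxplus_cong_mass[symmetric])
    qed
    also have "\<dots> = (SUP n. maxplus (u n) x)"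
      using u umono by (intro maxplus_SUP monoI)
    finally show ?thesis .
  qed
  have "mass (\<lambda>x. maxplus h x epowr p * ennreal (w x)) (E m) \<le> D" for m
  proof -
    have "mass (\<lambda>x. maxplus h x epowr p * ennreal (w x)) (E m)
        = mass (\<lambda>x. SUP n. maxplus (u n) x epowr p * ennreal (w x)) (E m)"
      using p by (intro mass_cong) (auto simp: E_def lim epowr_SUP SUP_mult_right_ennreal)
    also have "\<dots> = (SUP n. mass (\<lambda>x. maxplus (u n) x epowr p * ennreal (w x)) (E m))"
      using p by (intro mass_monotone_convergence monoI mult_right_mono epowr_mono maxplus_mono umono) auto
    also have "\<dots> \<le> D"
    proof (rule SUP_least)
      fix n
      have "mass (\<lambda>x. maxplus (u n) x epowr p * ennreal (w x)) (E m)
          \<le> mass (\<lambda>x. maxplus (u (max m n)) x epowr p * ennreal (w x)) (E (max m n))"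
        using p by (intro mass_mono mult_right_mono epowr_mono maxplus_mono umono Emono) auto
      also have "\<dots> \<le> D" unfolding u_def E_def by (rule windows)
      finally show "mass (\<lambda>x. maxplus (u n) x epowr p * ennreal (w x)) (E m) \<le> D" .
    qed
    finally show ?thesis .
  qed
  moreover have "mass (\<lambda>x. maxplus h x epowr p * ennreal (w x)) (\<Union>n. E n)
      = (SUP n. mass (\<lambda>x. maxplus h x epowr p * ennreal (w x)) (E n))"
  proof (rule mass_SUP_sets)
    show "(\<lambda>x. maxplus h x epowr p * ennreal (w x)) \<in> borel_measurable lebesgue"
      using maxplus_measurable[OF h] by measurable
    show "incseq E" by (intro monoI Emono)
  qed simp
  ultimately show ?thesis unfolding UE by (auto intro: SUP_least)
qed

lemma weight_null_left_of_infinite_dual: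
  assumes p: "1 < p" and A: "Ap_plus_const p w < top"
    and "a < b" "b < c" and inf: "mass (dual_weight p w) {b<..<c} = top"
  shows "mass (\<lambda>x. ennreal (w x)) {a<..<b} = 0"
proof (rule ccontr)
  assume "mass (\<lambda>x. ennreal (w x)) {a<..<b} \<noteq> 0"
  then have "mass (\<lambda>x. ennreal (w x)) {a<..<b} * mass (dual_weight p w) {b<..<c} epowr (p - 1) = top"
    using p by (simp add: inf epowr_top ennreal_mult_top)
  moreover have "Ap_plus_const p w * ennreal (c - a) epowr p < top"
    using A p assms by (simp add: epowr_ennreal ennreal_mult_less_top)
  ultimately show False using Ap_plus_interval[OF p assms(3,4), of w] by (simp add: top_unique)
qed

text \<open>
  Let \<open>P\<close> consist of the points to the right of which the dual weight is locally integrable. On the half-lines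
  starting in \<open>P\<close> the estimate is known, and to the left of a point outside \<open>P\<close> the weight vanishes. At most
  one point of the line belongs to neither kind of region.
\<close>

lemma strong_type_if_testing:
  assumes p: "1 < p" and w: "weight w" and A: "Ap_plus_const p w < top" and f: "f \<in> borel_measurable lebesgue"
    and finf: "mass (\<lambda>x. ennreal \<bar>f x\<bar> epowr p * ennreal (w x)) UNIV < top"
    and testing: "\<And>a b. a < b \<Longrightarrow> mass (dual_weight p w) {a<..<b} < top \<Longrightarrow>
      mass (\<lambda>x. maxplus (\<lambda>y. dual_weight p w y * indicator {a<..<b} y) x epowr p * ennreal (w x)) {a<..<b}
        \<le> K * mass (dual_weight p w) {a<..<b}"
  shows "mass (\<lambda>x. maxplus (\<lambda>y. ennreal \<bar>f y\<bar>) x epowr p * ennreal (w x)) UNIV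
    \<le> ennreal (strong_type_constant p) * K * mass (\<lambda>x. ennreal \<bar>f x\<bar> epowr p * ennreal (w x)) UNIV"
    (is "mass ?G UNIV \<le> ?D")
proof -
  let ?\<sigma> = "dual_weight p w" and ?W = "\<lambda>x. ennreal (w x)"
  note [measurable] = weight_measurable[OF w] f
  have h: "(\<lambda>y. ennreal \<bar>f y\<bar>) \<in> borel_measurable lebesgue" by measurable
  have G: "?G \<in> borel_measurable lebesgue" using maxplus_measurable[OF h] by measurable
  define P where "P = {q. \<forall>c. mass ?\<sigma> {q<..<c} < top}"
  have half: "mass ?G {q<..} \<le> ?D" if "q \<in> P" for q
    using that by (intro strong_type_on_half_line strong_type_on_window p w f h finf testing) (auto simp: P_def)
  define Q where "Q = (\<Union>q\<in>P. {q<..})"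
  have oQ: "open Q" unfolding Q_def by auto
  have massQ: "mass ?G Q \<le> ?D"
  proof (cases "P = {}")
    case True
    then show ?thesis by (simp add: Q_def mass_def)
  next
    case False
    obtain F where F: "F \<subseteq> greaterThan ` P" "countable F" "\<Union>F = Q"
      using Lindelof[of "greaterThan ` P"] unfolding Q_def by (metis (no_types, lifting) imageE open_greaterThan)
    then obtain P' where P': "P' \<subseteq> P" "countable P'" "(\<Union>q\<in>P'. {q<..}) = Q"
      using countable_subset_image[of F greaterThan P] by auto
    then have "P' \<noteq> {}" using False by (auto simp: Q_def)
    define r where "r = from_nat_into P'"
    have r: "range r = P'" unfolding r_def using \<open>P' \<noteq> {}\<close> P'(2) by (rule range_from_nat_into)
    \<comment> \<open>Finite unions of half-lines are half-lines, so the bound passes to the increasing limit.\<close>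
    define V where "V n = {Min (r ` {..n})<..}" for n :: nat
    have V: "mass ?G (V n) \<le> ?D" for n
    proof -
      have "Min (r ` {..n}) \<in> r ` {..n}" by (intro Min_in) auto
      then have "Min (r ` {..n}) \<in> P'" unfolding r[symmetric] by blast
      then have "Min (r ` {..n}) \<in> P" using P'(1) by blast
      then show ?thesis unfolding V_def by (rule half)
    qed
    have UV: "(\<Union>n. V n) = Q"
    proof -
      have "V n = (\<Union>i\<le>n. {r i<..})" for n unfolding V_def by (auto simp: Min_less_iff)
      then show ?thesis unfolding P'(3)[symmetric] r[symmetric] by auto
    qed
    have "mass ?G (\<Union>n. V n) = (SUP n. mass ?G (V n))"
    proof (rule mass_SUP_sets[OF G])
      show "incseq V" unfolding V_def
        by (intro monoI) (auto intro: le_less_trans[OF Min_antimono])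
    qed (auto simp: V_def)
    also have "\<dots> \<le> ?D" by (intro SUP_least V)
    finally show ?thesis unfolding UV .
  qed
  define Z where "Z = \<Union>{{a<..<q} |a q. a < q \<and> q \<notin> P}"
  \<comment> \<open>The covering estimate with density \<open>0\<close>: an arbitrary union of null intervals is null.\<close>
  have "1 * mass ?W Z \<le> 2 * mass (\<lambda>_. 0) Z"
    unfolding Z_def
  proof (rule mass_Union_le)
    fix J assume "J \<in> {{a<..<q} |a q. a < q \<and> q \<notin> P}"
    then obtain a q where J: "J = {a<..<q}" "a < q" "q \<notin> P" by auto
    then obtain c where c: "mass ?\<sigma> {q<..<c} = top" by (auto simp: P_def not_less top_unique)
    then have "q < c" by (cases "q < c") (auto simp: mass_def)
    then show "1 * mass ?W J \<le> mass (\<lambda>_. 0) J"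
      using weight_null_left_of_infinite_dual[OF p A J(2) _ c] J by simp
  qed auto
  then have W0: "mass ?W Z = 0" by (simp add: mass_def)
  have oZ: "open Z" unfolding Z_def by auto
  have "x = y" if "x \<notin> Q \<union> Z" "y \<notin> Q \<union> Z" for x y
  proof -
    have False if "x < y" "x \<notin> Q \<union> Z" "y \<notin> Q \<union> Z" for x y
    proof (cases "(x + y) / 2 \<in> P")
      case True
      then have "y \<in> Q" using \<open>x < y\<close> by (auto simp: Q_def intro!: bexI[of _ "(x + y) / 2"])
      then show False using that by simp
    next
      case False
      then have "x \<in> Z" unfolding Z_def using \<open>x < y\<close>
        by (intro UnionI[of "{x - 1<..<(x + y) / 2}"] CollectI exI conjI refl) auto
      then show False using that by simp
    qed
    then show ?thesis using that by (meson linorder_neqE)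
  qed
  then obtain x0 where x0: "UNIV - (Q \<union> Z) \<subseteq> {x0}" by blast
  have "mass ?G UNIV = mass ?G (Q \<union> Z)"
    by (rule mass_cong_AE) (use AE_lebesgue_neq[of x0] x0 in \<open>auto elim!: eventually_mono\<close>)
  also have "\<dots> = mass ?G (Q \<union> (Z - Q))" by simp
  also have "\<dots> = mass ?G Q + mass ?G (Z - Q)"
    using G oQ oZ by (intro mass_Un) (auto simp: sets_lebesgue_open)
  also have "mass ?G (Z - Q) \<le> mass ?G Z" by (intro mass_mono) auto
  also have "mass ?G Z = 0" using oZ W0 by (intro mass_times_null) (auto simp: sets_lebesgue_open)
  finally show ?thesis using massQ by simp
qed

lemma Lp_norm_le_if_power_le:
  assumes p: "1 < p" and C: "0 \<le> C"
    and le: "mass (\<lambda>x. g x epowr p * ennreal (w x)) UNIV \<le> ennreal C * K * mass (\<lambda>x. h x epowr p * ennreal (w x)) UNIV"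
  shows "Lp_norm p w g \<le> ennreal (C powr (1 / p)) * K epowr (1 / p) * Lp_norm p w h"
proof -
  have "Lp_norm p w g \<le> (ennreal C * K * mass (\<lambda>x. h x epowr p * ennreal (w x)) UNIV) epowr (1 / p)"
    unfolding Lp_norm_def using p le by (intro epowr_mono) (auto simp: mass_def)
  also have "\<dots> = ennreal (C powr (1 / p)) * K epowr (1 / p) * Lp_norm p w h"
    using p C by (simp add: epowr_mult epowr_ennreal Lp_norm_def mass_def)
  finally show ?thesis .
qed

theorem theorem1:
  fixes p :: real
  assumes "1 < p"
  shows "\<exists>c::real. c > 0 \<and>
    (\<forall>w f. w \<in> Ap_plus p \<longrightarrow> in_Lp p w f \<longrightarrow>
      Lp_norm p w (maxplus (\<lambda>y. ennreal \<bar>f y\<bar>))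
        \<le> ennreal c * (Ap_plus_const p w epowr (1 / (p - 1))) *
          Lp_norm p w (\<lambda>x. ennreal \<bar>f x\<bar>) \<and>
      Lp_norm p w (maxplus (\<lambda>y. ennreal \<bar>f y\<bar>))
        \<le> ennreal c *
          ((Ap_plus_const p w * Ainf_minus_const (dual_weight p w)) epowr (1 / p)) *
          Lp_norm p w (\<lambda>x. ennreal \<bar>f x\<bar>))"
proof -
  note p = assms
  have S: "0 < strong_type_constant p"
    using p powr_less_one[of 2 "- (p - 1)"] by (simp add: strong_type_constant_def)
  have M: "0 < dual_average_constant p" by (simp add: dual_average_constant_def)
  define C1 where "C1 = strong_type_constant p * (2 * 4 powr p * dual_average_constant p)"
  define C2 where "C2 = strong_type_constant p * (2 * 4 powr p)"
  have C: "0 < C1" "0 < C2" using S M by (auto simp: C1_def C2_def)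
  define c where "c = C1 powr (1 / p) + C2 powr (1 / p)"
  have c: "0 < c" "C1 powr (1 / p) \<le> c" "C2 powr (1 / p) \<le> c"
    using C by (auto simp: c_def intro: add_pos_pos)
  have main: "Lp_norm p w (maxplus (\<lambda>y. ennreal \<bar>f y\<bar>))
        \<le> ennreal c * (Ap_plus_const p w epowr (1 / (p - 1))) * Lp_norm p w (\<lambda>x. ennreal \<bar>f x\<bar>) \<and>
      Lp_norm p w (maxplus (\<lambda>y. ennreal \<bar>f y\<bar>))
        \<le> ennreal c * ((Ap_plus_const p w * Ainf_minus_const (dual_weight p w)) epowr (1 / p)) *
          Lp_norm p w (\<lambda>x. ennreal \<bar>f x\<bar>)"
    if wA: "w \<in> Ap_plus p" and f: "in_Lp p w f" for w f
  proof -
    have w: "weight w" and A: "Ap_plus_const p w < top" using wA by (auto simp: Ap_plus_def)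
    have fm: "f \<in> borel_measurable lebesgue" using f by (simp add: in_Lp_def)
    have fin: "mass (\<lambda>x. ennreal \<bar>f x\<bar> epowr p * ennreal (w x)) UNIV < top"
    proof (rule ccontr)
      assume "\<not> ?thesis"
      then have "Lp_norm p w (\<lambda>x. ennreal \<bar>f x\<bar>) = top"
        using p by (simp add: Lp_norm_def mass_def not_less top_unique epowr_top)
      then show False using f by (simp add: in_Lp_def)
    qed
    note bound = strong_type_if_testing[OF p w A fm fin]
    have "Lp_norm p w (maxplus (\<lambda>y. ennreal \<bar>f y\<bar>))
        \<le> ennreal (C1 powr (1 / p)) * (Ap_plus_const p w epowr (p / (p - 1))) epowr (1 / p) * Lp_norm p w (\<lambda>x. ennreal \<bar>f x\<bar>)"
    proof (rule Lp_norm_le_if_power_le[OF p])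
      have "ennreal C1 = ennreal (strong_type_constant p) * ennreal (2 * 4 powr p * dual_average_constant p)"
        unfolding C1_def using S M by (intro ennreal_mult) auto
      then show "mass (\<lambda>x. maxplus (\<lambda>y. ennreal \<bar>f y\<bar>) x epowr p * ennreal (w x)) UNIV
          \<le> ennreal C1 * Ap_plus_const p w epowr (p / (p - 1)) * mass (\<lambda>x. ennreal \<bar>f x\<bar> epowr p * ennreal (w x)) UNIV"
        using bound[OF testing_Ap[OF p w A]] by (simp only: mult.assoc)
    qed (use C in simp)
    also have "(Ap_plus_const p w epowr (p / (p - 1))) epowr (1 / p) = Ap_plus_const p w epowr (1 / (p - 1))"
      using p by (subst epowr_epowr) auto
    also have "ennreal (C1 powr (1 / p)) * Ap_plus_const p w epowr (1 / (p - 1)) * Lp_norm p w (\<lambda>x. ennreal \<bar>f x\<bar>)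
        \<le> ennreal c * Ap_plus_const p w epowr (1 / (p - 1)) * Lp_norm p w (\<lambda>x. ennreal \<bar>f x\<bar>)"
      using c by (intro mult_right_mono ennreal_leI) auto
    finally have 1: "Lp_norm p w (maxplus (\<lambda>y. ennreal \<bar>f y\<bar>))
        \<le> ennreal c * Ap_plus_const p w epowr (1 / (p - 1)) * Lp_norm p w (\<lambda>x. ennreal \<bar>f x\<bar>)" .
    have "Lp_norm p w (maxplus (\<lambda>y. ennreal \<bar>f y\<bar>))
        \<le> ennreal (C2 powr (1 / p)) * (Ap_plus_const p w * Ainf_minus_const (dual_weight p w)) epowr (1 / p) * Lp_norm p w (\<lambda>x. ennreal \<bar>f x\<bar>)"
    proof (rule Lp_norm_le_if_power_le[OF p])
      have "ennreal C2 = ennreal (strong_type_constant p) * ennreal (2 * 4 powr p)"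
        unfolding C2_def using S by (intro ennreal_mult) auto
      then show "mass (\<lambda>x. maxplus (\<lambda>y. ennreal \<bar>f y\<bar>) x epowr p * ennreal (w x)) UNIV
          \<le> ennreal C2 * (Ap_plus_const p w * Ainf_minus_const (dual_weight p w)) * mass (\<lambda>x. ennreal \<bar>f x\<bar> epowr p * ennreal (w x)) UNIV"
        using bound[OF testing_Ainf[OF p w]] by (simp only: mult.assoc)
    qed (use C in simp)
    also have "\<dots> \<le> ennreal c * (Ap_plus_const p w * Ainf_minus_const (dual_weight p w)) epowr (1 / p) * Lp_norm p w (\<lambda>x. ennreal \<bar>f x\<bar>)"
      using c by (intro mult_right_mono ennreal_leI) auto
    finally show ?thesis using 1 by blast
  qed
  show ?thesis using c(1) main by (intro exI[of _ c]) blast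
qed

end
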